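(* Let $(W_t)_{t\ge0}$ be a standard one-dimensional Brownian motion and let $\mathcal U$ be the set of all processes $(u_s)_{s\ge0}$ progressively measurable with respect to the filtration generated by $W$ with $u_s\in[0,1]$ for all $s\ge0$. For $x,y>0$ and $u\in\mathcal U$ set $$X^{x,u}_t=x+W_t+\int_0^tu_s\,ds,\qquad Y^{y,u}_t=y+W_t+\int_0^t(1-u_s)\,ds,$$ $\tau(x,y;u)=\inf\{t\ge0: X^{x,u}_t\le0\text{ or }Y^{y,u}_t\le0\}$ and $V(x,y)=\sup_{u\in\mathcal U}\mathbb P[\tau(x,y;u)=\infty]$. Then, with $\Phi$ the standard normal distribution function, $$V(x,y)=1-e^{-x}\quad\text{if } y=x,$$ and for $y\ne x$ $$V(x,y)=\Phi\!\left(\frac{\max\{x,y\}}{\sqrt{|y-x|}}\right)-e^{-2\min\{x,y\}}\,\Phi\!\left(\frac{|y-x|-\min\{x,y\}}{\sqrt{|y-x|}}\right)-e^{-\frac{x+y}{2}}\left(2\Phi\!\left(\frac{\min\{x,y\}}{\sqrt{|y-x|}}\right)-1\right).$$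
   Context: This is the two-company ruin minimization problem with perfectly positively correlated Brownian motions ($\rho=1$), total drift $\bar\mu=\mu_1+\mu_2=1$ and $\delta=0$ (so the total drift of each company stays nonnegative). *)

theory Defs
  imports "HOL-Probability.Probability"
begin

definition Phi :: "real \<Rightarrow> real" where
  "Phi z = (LINT t:{..z}|lborel. std_normal_density t)"

definition std_brownian_motion :: "'a measure \<Rightarrow> (real \<Rightarrow> 'a \<Rightarrow> real) \<Rightarrow> bool" where
  "std_brownian_motion M W \<longleftrightarrow>
     prob_space M \<and>
     (\<forall>t. W t \<in> borel_measurable M) \<and>
     (\<forall>\<omega>\<in>space M. W 0 \<omega> = 0 \<and> continuous_on {0..} (\<lambda>t. W t \<omega>)) \<and>
     (\<forall>s t. 0 \<le> s \<and> s < t \<longrightarrow>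
        distributed M lborel (\<lambda>\<omega>. W t \<omega> - W s \<omega>) (normal_density 0 (sqrt (t - s)))) \<and>
     (\<forall>(ts :: nat \<Rightarrow> real) n. 0 \<le> ts 0 \<and> (\<forall>i<n. ts i < ts (Suc i)) \<longrightarrow>
        prob_space.indep_vars M (\<lambda>_. borel) (\<lambda>i \<omega>. W (ts (Suc i)) \<omega> - W (ts i) \<omega>) {..<n})"

definition nat_filtration :: "'a measure \<Rightarrow> (real \<Rightarrow> 'a \<Rightarrow> real) \<Rightarrow> real \<Rightarrow> 'a measure" where
  "nat_filtration M W t =
     sigma (space M) (\<Union>s\<in>{0..t}. {W s -` B \<inter> space M | B. B \<in> sets borel})"

definition admissible_controls :: "'a measure \<Rightarrow> (real \<Rightarrow> 'a \<Rightarrow> real) \<Rightarrow> (real \<Rightarrow> 'a \<Rightarrow> real) set" where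
  "admissible_controls M W =
     {u. (\<forall>s\<ge>0. \<forall>\<omega>\<in>space M. 0 \<le> u s \<omega> \<and> u s \<omega> \<le> 1) \<and>
         (\<forall>t\<ge>0. (\<lambda>(s, \<omega>). u s \<omega>) \<in>
             borel_measurable (restrict_space borel {0..t} \<Otimes>\<^sub>M nat_filtration M W t))}"

definition X_proc :: "(real \<Rightarrow> 'a \<Rightarrow> real) \<Rightarrow> real \<Rightarrow> (real \<Rightarrow> 'a \<Rightarrow> real) \<Rightarrow> real \<Rightarrow> 'a \<Rightarrow> real" where
  "X_proc W x u t \<omega> = x + W t \<omega> + (LINT s:{0..t}|lborel. u s \<omega>)"

definition Y_proc :: "(real \<Rightarrow> 'a \<Rightarrow> real) \<Rightarrow> real \<Rightarrow> (real \<Rightarrow> 'a \<Rightarrow> real) \<Rightarrow> real \<Rightarrow> 'a \<Rightarrow> real" where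
  "Y_proc W y u t \<omega> = y + W t \<omega> + (LINT s:{0..t}|lborel. 1 - u s \<omega>)"

text \<open>The event {tau(x,y;u) = infinity}: neither process ever reaches (-inf,0].\<close>
definition survival_event :: "'a measure \<Rightarrow> (real \<Rightarrow> 'a \<Rightarrow> real) \<Rightarrow> real \<Rightarrow> real \<Rightarrow> (real \<Rightarrow> 'a \<Rightarrow> real) \<Rightarrow> 'a set" where
  "survival_event M W x y u =
     {\<omega>\<in>space M. \<forall>t\<ge>0. X_proc W x u t \<omega> > 0 \<and> Y_proc W y u t \<omega> > 0}"

definition value_fun :: "'a measure \<Rightarrow> (real \<Rightarrow> 'a \<Rightarrow> real) \<Rightarrow> real \<Rightarrow> real \<Rightarrow> real" where
  "value_fun M W x y = (SUP u\<in>admissible_controls M W. measure M (survival_event M W x y u))"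

end

theory Submission
  imports Defs "HOL-Real_Asymp.Real_Asymp"
begin

text \<open>
  No stochastic calculus is needed. The sum of the two reserves does not depend on the control and
  their difference moves at speed at most \<open>1\<close>, so the control that gives all drift to the poorer
  company until time \<open>d = \<bar>y - x\<bar>\<close> and shares it equally afterwards maximises the smaller reserve
  at every time on every path. Hence \<open>V(x,y)\<close> is the probability that
  \<open>min x y + W t + min t ((t + d) / 2)\<close> stays positive. For drift \<open>1/2\<close> this would be \<open>1 - exp (- z)\<close>;
  before time \<open>d\<close> one extends this function to negative \<open>z\<close> by reflection, with the weight
  \<open>- exp (2 z)\<close> that accounts for drift \<open>1\<close>, so that its Gaussian means vanish at the barrier.
  These means are computed in closed form. That they give the survival probability follows by
  comparison along time grids: killing the discrete walk below \<open>0\<close> discards only nonpositive values,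
  which is a lower bound, and after a shift by \<open>\<epsilon>\<close> the discarded values are negligible, which is an
  upper bound.
\<close>

section \<open>Gaussian integrals\<close>

text \<open>The parameter is the variance, so it adds under convolution and equals the length of a
  Brownian time increment.\<close>

definition gauss :: "real \<Rightarrow> real measure" where
  "gauss s = density lborel (\<lambda>x. ennreal (normal_density 0 (sqrt s) x))"

lemma sets_gauss [simp, measurable_cong]: "sets (gauss s) = sets borel"
  by (simp add: gauss_def)

lemma space_gauss [simp]: "space (gauss s) = UNIV"
  by (simp add: gauss_def)

lemma prob_space_gauss: "0 < s \<Longrightarrow> prob_space (gauss s)"
  unfolding gauss_def by (rule prob_space_normal_density) simp

text \<open>Completing the square: an exponential tilt by \<open>a\<close> shifts the mean of a
  centred Gaussian of variance \<open>s\<close> by \<open>a * s\<close>.\<close>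

lemma exp_times_normal_density:
  assumes "0 < s"
  shows "exp (a * x) * normal_density 0 (sqrt s) x
       = exp (a\<^sup>2 * s / 2) * normal_density (a * s) (sqrt s) x"
proof -
  have "a * x + - (x\<^sup>2 / (2 * s)) = a\<^sup>2 * s / 2 + - ((x - a * s)\<^sup>2 / (2 * s))"
    using assms by (simp add: field_simps power2_eq_square)
  then have "exp (a * x) * exp (- (x\<^sup>2 / (2 * s)))
           = exp (a\<^sup>2 * s / 2) * exp (- ((x - a * s)\<^sup>2 / (2 * s)))"
    by (simp only: mult_exp_exp)
  then show ?thesis using assms by (simp add: normal_density_def)
qed

lemma has_bochner_integral_exp_gauss:
  assumes "0 < s"
  shows "has_bochner_integral (gauss s) (\<lambda>x. exp (a * x)) (exp (a\<^sup>2 * s / 2))"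
proof -
  have "has_bochner_integral lborel (\<lambda>x. normal_density (a * s) (sqrt s) x) 1"
    using assms by (simp add: has_bochner_integral_iff)
  then have "has_bochner_integral lborel
      (\<lambda>x. exp (a\<^sup>2 * s / 2) * normal_density (a * s) (sqrt s) x) (exp (a\<^sup>2 * s / 2) * 1)"
    by (rule has_bochner_integral_mult_right)
  then show ?thesis
    unfolding gauss_def using assms
    by (intro has_bochner_integral_density)
       (auto simp: exp_times_normal_density mult.commute[of "normal_density _ _ _"])
qed

lemma integrable_exp_gauss [simp]: "0 < s \<Longrightarrow> integrable (gauss s) (\<lambda>x. exp (a * x))"
  using has_bochner_integral_exp_gauss has_bochner_integral_iff by blast

lemma integral_exp_gauss [simp]: "0 < s \<Longrightarrow> (\<integral>x. exp (a * x) \<partial>gauss s) = exp (a\<^sup>2 * s / 2)"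
  using has_bochner_integral_exp_gauss has_bochner_integral_iff by blast

lemma gauss_convolution:
  assumes "0 < s" "0 < h"
  shows "convolution (gauss s) (gauss h) = gauss (s + h)"
proof -
  have "(\<integral>\<^sup>+y. ennreal (normal_density 0 (sqrt s) (x - y)) * ennreal (normal_density 0 (sqrt h) y) \<partial>lborel)
      = ennreal (normal_density 0 (sqrt (s + h)) x)" for x
    using fun_cong[OF conv_normal_density_zero_mean[of "sqrt s" "sqrt h"], of x] assms
    by (simp add: ennreal_mult'')
  then show ?thesis
    unfolding gauss_def using assms
    by (subst convolution_density)
       (auto intro!: prob_space.finite_measure prob_space_normal_density)
qed

text \<open>Fubini for the product measure, whose image under addition is
  \<open>gauss (s + h)\<close>.\<close>

lemma gauss_semigroup:
  fixes F :: "real \<Rightarrow> real"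
  assumes "0 < s" "0 < h" and F: "integrable (gauss (s + h)) F"
  shows "integrable (gauss h) (\<lambda>y. \<integral>x. F (x + y) \<partial>gauss s)"
    and "(\<integral>y. (\<integral>x. F (x + y) \<partial>gauss s) \<partial>gauss h) = (\<integral>z. F z \<partial>gauss (s + h))"
proof -
  interpret S: prob_space "gauss s" by (rule prob_space_gauss) fact
  interpret H: prob_space "gauss h" by (rule prob_space_gauss) fact
  interpret pair_sigma_finite "gauss h" "gauss s" ..
  have [measurable]: "F \<in> borel_measurable borel"
    using borel_measurable_integrable[OF F] by simp
  have eq: "gauss (s + h) = distr (gauss h \<Otimes>\<^sub>M gauss s) borel (\<lambda>(x, y). x + y)"
    using gauss_convolution[OF assms(2,1)] by (simp add: convolution_def add.commute)
  have int: "integrable (gauss h \<Otimes>\<^sub>M gauss s) (\<lambda>(y, x). F (x + y))"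
    using F unfolding eq
    by (subst (asm) integrable_distr_eq) (auto simp: case_prod_beta' add.commute)
  show "integrable (gauss h) (\<lambda>y. \<integral>x. F (x + y) \<partial>gauss s)"
    using integrable_fst'[OF int] by simp
  have "(\<integral>y. (\<integral>x. F (x + y) \<partial>gauss s) \<partial>gauss h) = (\<integral>z. (case z of (y, x) \<Rightarrow> F (x + y)) \<partial>(gauss h \<Otimes>\<^sub>M gauss s))"
    using integral_fst'[OF int] by simp
  also have "\<dots> = (\<integral>z. F z \<partial>gauss (s + h))"
    unfolding eq by (subst integral_distr) (auto simp: case_prod_beta' add.commute)
  finally show "(\<integral>y. (\<integral>x. F (x + y) \<partial>gauss s) \<partial>gauss h) = (\<integral>z. F z \<partial>gauss (s + h))" .
qed

lemma integral_gauss: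
  fixes F :: "real \<Rightarrow> real"
  assumes [measurable]: "F \<in> borel_measurable borel"
  shows "(\<integral>x. F x \<partial>gauss s) = (\<integral>x. normal_density 0 (sqrt s) x * F x \<partial>lborel)"
  unfolding gauss_def by (subst integral_density) auto

section \<open>The standard normal distribution function\<close>

lemma Phi_altdef: "Phi z = (\<integral>t. indicator {..z} t * std_normal_density t \<partial>lborel)"
  by (simp add: Phi_def set_lebesgue_integral_def)

text \<open>The exponential tilt moves the mean to \<open>- a * s\<close>; standardising with a
  negative scale factor then turns the upper tail into a lower one, which is a value of
  \<open>Phi\<close>.\<close>

lemma integral_exp_gauss_tail:
  assumes "0 < s"
  shows "(\<integral>x. indicator {-c..} x * exp (- a * x) \<partial>gauss s)
       = exp (a\<^sup>2 * s / 2) * Phi ((c - a * s) / sqrt s)"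
proof -
  have "(\<integral>x. indicator {-c..} x * exp (- a * x) \<partial>gauss s)
      = (\<integral>x. indicator {-c..} x * (exp (a\<^sup>2 * s / 2) * normal_density (- a * s) (sqrt s) x) \<partial>lborel)"
    using exp_times_normal_density[OF assms, of "-a"]
    by (subst integral_gauss) (auto intro!: Bochner_Integration.integral_cong simp: mult_ac)
  also have "\<dots> = exp (a\<^sup>2 * s / 2) * (\<integral>x. indicator {-c..} x * normal_density (- a * s) (sqrt s) x \<partial>lborel)"
    by (subst integral_mult_right_zero[symmetric]) (simp add: mult_ac)
  also have "(\<integral>x. indicator {-c..} x * normal_density (- a * s) (sqrt s) x \<partial>lborel)
     = sqrt s * (\<integral>x. indicator {-c..} (- a * s + - sqrt s * x)
                 * normal_density (- a * s) (sqrt s) (- a * s + - sqrt s * x) \<partial>lborel)"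
    using assms by (subst lborel_integral_real_affine[where c="- sqrt s" and t="- a * s"]) auto
  also have "\<dots> = (\<integral>x. sqrt s * (indicator {-c..} (- a * s + - sqrt s * x)
                 * normal_density (- a * s) (sqrt s) (- a * s + - sqrt s * x)) \<partial>lborel)"
    by simp
  also have "\<dots> = (\<integral>t. indicator {..(c - a * s) / sqrt s} t * std_normal_density t \<partial>lborel)"
  proof (rule Bochner_Integration.integral_cong)
    fix x :: real
    have 1: "indicator {-c..} (- a * s + - sqrt s * x) = (indicator {..(c - a * s) / sqrt s} x :: real)"
      using assms by (auto simp: indicator_def field_simps)
    have 2: "sqrt s * normal_density (- a * s) (sqrt s) (- a * s + - sqrt s * x) = std_normal_density x"
      using assms by (simp add: normal_density_def real_sqrt_mult power_mult_distrib)
    show "sqrt s * (indicator {-c..} (- a * s + - sqrt s * x)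
                 * normal_density (- a * s) (sqrt s) (- a * s + - sqrt s * x))
        = indicator {..(c - a * s) / sqrt s} x * std_normal_density x"
      unfolding 1 using 2 by (metis mult.left_commute)
  qed simp
  finally show ?thesis by (simp add: Phi_altdef)
qed

lemma Phi_uminus: "Phi (- z) = 1 - Phi z"
proof -
  have i: "integrable lborel (\<lambda>t. indicator A t * std_normal_density t)" if "A \<in> sets borel" for A
    using integrable_real_mult_indicator[OF _ integrable_normal_density[of 1 0], of A] that
    by (simp add: mult.commute)
  have "Phi (- z) = (\<integral>t. indicator {..-z} (0 + -1 * t) * std_normal_density (0 + -1 * t) \<partial>lborel)"
    unfolding Phi_altdef by (subst lborel_integral_real_affine[where c="-1" and t=0]) auto
  also have "\<dots> = (\<integral>t. indicator {z..} t * std_normal_density t \<partial>lborel)"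
    by (auto intro!: Bochner_Integration.integral_cong simp: indicator_def normal_density_def)
  also have "\<dots> = (\<integral>t. std_normal_density t - indicator {..z} t * std_normal_density t \<partial>lborel)"
    by (rule integral_cong_AE)
       (auto intro!: AE_I'[of "{z}"] simp: indicator_def split: if_splits)
  also have "\<dots> = 1 - Phi z"
    unfolding Phi_altdef using i by (subst Bochner_Integration.integral_diff) auto
  finally show ?thesis .
qed

text \<open>\<open>Phi\<close> is the distribution function of a law without atoms.\<close>

lemma continuous_Phi: "continuous_on UNIV Phi"
proof -
  let ?N = "density lborel (\<lambda>x. ennreal (std_normal_density x))"
  interpret N: real_distribution ?N
    by (rule real_dist_normal_dist)
  have eq: "Phi z = cdf ?N z" for z
  proof -
    have "cdf ?N z = (\<integral>t. indicator {..z} t \<partial>?N)" by (simp add: cdf_def)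
    also have "\<dots> = Phi z" unfolding Phi_altdef
      by (subst integral_density) (auto simp: mult.commute)
    finally show ?thesis by simp
  qed
  have "isCont (cdf ?N) z" for z
  proof -
    have "emeasure ?N {z} = 0"
      by (subst emeasure_density) (auto intro!: nn_integral_0_iff_AE[THEN iffD2] AE_I'[of "{z}"] simp: indicator_def)
    then show ?thesis by (simp add: N.isCont_cdf measure_def)
  qed
  then show ?thesis by (simp add: eq[abs_def] continuous_on_eq_continuous_at)
qed

section \<open>Reflected payoff and its Gaussian means\<close>

text \<open>The values for \<open>z < 0\<close> are dictated by \<open>payoff (- z) = - exp (2 * z) * payoff z\<close>, which makes
  \<open>val s 0 = 0\<close>.\<close>
definition payoff :: "real \<Rightarrow> real" where
  "payoff z = (if 0 \<le> z then 1 - exp (- z) else exp (- z) - exp (- 2 * z))"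

text \<open>The case \<open>s = 0\<close> is separate because the density of variance \<open>0\<close> is the zero function.\<close>
definition val :: "real \<Rightarrow> real \<Rightarrow> real" where
  "val s z = (if s = 0 then payoff z else \<integral>x. payoff (z + s + x) \<partial>gauss s)"

lemma payoff_measurable [measurable]: "payoff \<in> borel_measurable borel"
  unfolding payoff_def by measurable

lemma payoff_uminus: "payoff (- z) = - exp (2 * z) * payoff z"
proof -
  have "exp (2 * z) = exp z * exp z" "exp (2 * z) * exp (- z) = exp z" "exp (2 * z) * exp (- (2 * z)) = 1"
    by (simp_all add: mult_exp_exp)
  then show ?thesis by (auto simp: payoff_def algebra_simps)
qed

lemma payoff_nonneg: "0 \<le> z \<Longrightarrow> 0 \<le> payoff z"
  by (simp add: payoff_def)

lemma payoff_nonpos: "z \<le> 0 \<Longrightarrow> payoff z \<le> 0"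
  by (simp add: payoff_def)

lemma payoff_le_1: "payoff z \<le> 1"
proof (cases "0 \<le> z")
  case False
  then have "exp (- z) \<le> exp (- 2 * z)" by simp
  then have "exp (- z) - exp (- 2 * z) \<le> 0" by linarith
  then have "payoff z \<le> 0" using False by (simp add: payoff_def)
  then show ?thesis by simp
qed (simp add: payoff_def)

lemma payoff_ge: "- exp (- 2 * z) \<le> payoff z"
  using exp_gt_zero[of "- z"] exp_gt_zero[of "- 2 * z"]
  by (auto simp: payoff_def intro: order_trans[of _ 0])

lemma integrable_payoff:
  assumes "0 < s"
  shows "integrable (gauss s) (\<lambda>x. payoff (c + x))"
proof (rule Bochner_Integration.integrable_bound)
  interpret prob_space "gauss s" by (rule prob_space_gauss) fact
  show "integrable (gauss s) (\<lambda>x. 1 + exp (- 2 * c) * exp (- 2 * x))"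
    using assms by (intro Bochner_Integration.integrable_add integrable_mult_right integrable_exp_gauss) auto
  show "AE x in gauss s. norm (payoff (c + x)) \<le> norm (1 + exp (- 2 * c) * exp (- 2 * x))"
  proof (intro always_eventually allI)
    fix x
    have "- exp (- 2 * (c + x)) \<le> payoff (c + x)" "payoff (c + x) \<le> 1"
      by (rule payoff_ge payoff_le_1)+
    then have "\<bar>payoff (c + x)\<bar> \<le> 1 + exp (- 2 * (c + x))"
      using exp_gt_zero[of "- 2 * (c + x)"] by linarith
    moreover have "exp (- 2 * c) * exp (- 2 * x) = exp (- 2 * (c + x))"
      by (simp add: mult_exp_exp)
    ultimately show "norm (payoff (c + x)) \<le> norm (1 + exp (- 2 * c) * exp (- 2 * x))"
      by simp
  qed
qed measurable

lemma borel_measurable_val: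
  assumes "0 \<le> s" shows "val s \<in> borel_measurable borel"
proof (cases "s = 0")
  case False
  with assms interpret prob_space "gauss s" by (intro prob_space_gauss) simp
  show ?thesis using False unfolding val_def[abs_def] by simp
qed (simp add: val_def[abs_def])

lemma val_le_1:
  assumes "0 \<le> s" shows "val s z \<le> 1"
proof (cases "s = 0")
  case False
  with assms interpret prob_space "gauss s" by (intro prob_space_gauss) simp
  have "(\<integral>x. payoff (z + s + x) \<partial>gauss s) \<le> (\<integral>x. 1 \<partial>gauss s)"
    using False assms by (intro integral_mono integrable_payoff payoff_le_1) auto
  then show ?thesis using False prob_space by (simp add: val_def)
qed (simp add: val_def payoff_le_1)

text \<open>A Gaussian step with drift 1 reproduces \<open>exp (- 2 * z)\<close>, because
  \<open>- 2 * s + (- 2)^2 * s / 2 = 0\<close>. Hence the bound \<open>payoff_ge\<close> passes to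
  \<open>val\<close> unchanged.\<close>

lemma val_ge:
  assumes "0 \<le> s" shows "- exp (- 2 * z) \<le> val s z"
proof (cases "s = 0")
  case False
  with assms have s: "0 < s" by simp
  then interpret prob_space "gauss s" by (rule prob_space_gauss)
  have "exp (- 2 * (z + s)) * exp ((- 2)\<^sup>2 * s / 2) = exp (- 2 * z)"
    by (simp add: mult_exp_exp)
  then have "- exp (- 2 * z) = (\<integral>x. - (exp (- 2 * (z + s)) * exp (- 2 * x)) \<partial>gauss s)"
    using s by (simp only: integral_minus integral_mult_right_zero integral_exp_gauss)
  also have "\<dots> \<le> (\<integral>x. payoff (z + s + x) \<partial>gauss s)"
  proof (rule integral_mono)
    show "integrable (gauss s) (\<lambda>x. - (exp (- 2 * (z + s)) * exp (- 2 * x)))"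
      using s by (intro Bochner_Integration.integrable_minus integrable_mult_right integrable_exp_gauss)
    show "integrable (gauss s) (\<lambda>x. payoff (z + s + x))"
      using s by (rule integrable_payoff)
    fix x show "- (exp (- 2 * (z + s)) * exp (- 2 * x)) \<le> payoff (z + s + x)"
      using payoff_ge[of "z + s + x"] by (simp add: mult_exp_exp algebra_simps)
  qed
  finally show ?thesis using False by (simp add: val_def)
qed (use payoff_ge in \<open>simp add: val_def\<close>)

text \<open>Reflection principle: the integral is written once over \<open>y\<close> and once over
  \<open>- y\<close>, and the two forms are added. The antisymmetry \<open>payoff_uminus\<close>
  merges them into one integral whose kernel vanishes at the barrier \<open>z = 0\<close>.\<close>

lemma two_val_eq:
  assumes s: "0 < s"
  shows "2 * val s z = (\<integral>y. normal_density 0 (sqrt s) (y - z - s) * payoff y * (1 - exp (- 2 * y * z / s)) \<partial>lborel)"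
proof -
  let ?n = "normal_density 0 (sqrt s)"
  have I0: "integrable lborel (\<lambda>x. ?n x * payoff (z + s + x))"
    using integrable_payoff[OF s, of "z + s"] unfolding gauss_def
    by (subst (asm) integrable_density) auto
  have v: "val s z = (\<integral>x. ?n x * payoff (z + s + x) \<partial>lborel)"
    using s by (simp add: val_def integral_gauss)
  have I1: "integrable lborel (\<lambda>y. ?n (y - z - s) * payoff y)"
    using lborel_integrable_real_affine[OF I0, of 1 "- z - s"] by (simp add: algebra_simps)
  have v1: "val s z = (\<integral>y. ?n (y - z - s) * payoff y \<partial>lborel)"
    unfolding v by (subst lborel_integral_real_affine[where c=1 and t="- z - s"]) (auto simp: algebra_simps)
  have I2: "integrable lborel (\<lambda>y. ?n (- y - z - s) * payoff (- y))"
    using lborel_integrable_real_affine[OF I1, of "-1" 0] by simp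
  have v2: "val s z = (\<integral>y. ?n (- y - z - s) * payoff (- y) \<partial>lborel)"
    unfolding v1 by (subst lborel_integral_real_affine[where c="-1" and t=0]) auto
  have eq: "?n (- y - z - s) * payoff (- y) = - (?n (y - z - s) * payoff y * exp (- 2 * y * z / s))" for y
  proof -
    \<comment> \<open>Reflecting \<open>y\<close> changes the exponent by
      \<open>- 2 * y * (z + s) / s\<close>; the weight \<open>exp (2 * y)\<close> from
      \<open>payoff_uminus\<close> cancels the drift part \<open>- 2 * y\<close> of this.\<close>
    have "- (- y - z - s)\<^sup>2 / (2 * s) + 2 * y = - (y - z - s)\<^sup>2 / (2 * s) + (- 2 * y * z / s)"
      using s by (simp add: field_simps power2_eq_square)
    then have "exp (- (- y - z - s)\<^sup>2 / (2 * s)) * exp (2 * y)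
             = exp (- (y - z - s)\<^sup>2 / (2 * s)) * exp (- 2 * y * z / s)"
      by (simp only: mult_exp_exp)
    then have "?n (- y - z - s) * exp (2 * y) = ?n (y - z - s) * exp (- 2 * y * z / s)"
      using s by (simp add: normal_density_def)
    then have "payoff y * (?n (- y - z - s) * exp (2 * y)) = payoff y * (?n (y - z - s) * exp (- 2 * y * z / s))"
      by simp
    then show ?thesis unfolding payoff_uminus by (simp only: mult_ac minus_mult_left[symmetric] minus_mult_right[symmetric])
  qed
  have alg: "?n (y - z - s) * payoff y * (1 - exp (- 2 * y * z / s))
     = ?n (y - z - s) * payoff y + ?n (- y - z - s) * payoff (- y)" for y
    unfolding eq by (simp add: algebra_simps)
  show "2 * val s z = (\<integral>y. ?n (y - z - s) * payoff y * (1 - exp (- 2 * y * z / s)) \<partial>lborel)"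
    unfolding alg using I1 I2 v1 v2 by (subst Bochner_Integration.integral_add) auto
qed

text \<open>\<open>payoff y\<close> has the sign of \<open>y\<close> and the bracket has the sign of
  \<open>y * z\<close>, so the sign of the product is decided by \<open>z\<close> alone.\<close>

lemma payoff_kernel_sign:
  assumes "0 < s"
  shows "0 \<le> z \<Longrightarrow> 0 \<le> payoff y * (1 - exp (- 2 * y * z / s))"
    and "z \<le> 0 \<Longrightarrow> payoff y * (1 - exp (- 2 * y * z / s)) \<le> 0"
proof -
  have e: "- 2 * y * z / s = - (2 / s * (y * z))" by simp
  have pos: "0 \<le> 1 - exp (- 2 * y * z / s)" if "0 \<le> y * z"
    unfolding e using that assms mult_nonneg_nonneg[of "2 / s" "y * z"] by simp
  have neg: "1 - exp (- 2 * y * z / s) \<le> 0" if "y * z \<le> 0"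
    unfolding e using that assms mult_nonneg_nonpos[of "2 / s" "y * z"] by simp
  show "0 \<le> payoff y * (1 - exp (- 2 * y * z / s))" if "0 \<le> z"
  proof (cases "0 \<le> y")
    case True
    with that show ?thesis by (intro mult_nonneg_nonneg payoff_nonneg pos)
  next
    case False
    with that show ?thesis by (intro mult_nonpos_nonpos payoff_nonpos neg mult_nonpos_nonneg) simp_all
  qed
  show "payoff y * (1 - exp (- 2 * y * z / s)) \<le> 0" if "z \<le> 0"
  proof (cases "0 \<le> y")
    case True
    with that show ?thesis by (intro mult_nonneg_nonpos payoff_nonneg neg mult_nonneg_nonpos)
  next
    case False
    with that show ?thesis by (intro mult_nonpos_nonneg payoff_nonpos pos mult_nonpos_nonpos) simp_all
  qed
qed

lemma val_nonneg:
  assumes "0 \<le> s" "0 \<le> z" shows "0 \<le> val s z"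
proof (cases "s = 0")
  case False
  with assms have s: "0 < s" by simp
  have "0 \<le> 2 * val s z"
    unfolding two_val_eq[OF s] mult.assoc[of "normal_density _ _ _" "payoff _"]
    by (rule Bochner_Integration.integral_nonneg,
        rule mult_nonneg_nonneg[OF normal_density_nonneg payoff_kernel_sign(1)[OF s assms(2)]])
  then show ?thesis by simp
qed (use assms in \<open>simp add: val_def payoff_nonneg\<close>)

lemma val_nonpos:
  assumes "0 \<le> s" "z \<le> 0" shows "val s z \<le> 0"
proof (cases "s = 0")
  case False
  with assms have s: "0 < s" by simp
  have "0 \<le> (\<integral>y. - (normal_density 0 (sqrt s) (y - z - s) * (payoff y * (1 - exp (- 2 * y * z / s)))) \<partial>lborel)"
    by (rule Bochner_Integration.integral_nonneg, subst neg_0_le_iff_le,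
        rule mult_nonneg_nonpos[OF normal_density_nonneg payoff_kernel_sign(2)[OF s assms(2)]])
  then have "2 * val s z \<le> 0"
    unfolding two_val_eq[OF s] mult.assoc[of "normal_density _ _ _" "payoff _"]
    by simp
  then show ?thesis by simp
qed (use assms in \<open>simp add: val_def payoff_nonpos\<close>)

text \<open>Chapman-Kolmogorov for drift 1: the drift and the variance of a step of length
  \<open>h\<close> both add to the remaining time \<open>s\<close>.\<close>

lemma val_semigroup:
  assumes "0 \<le> s" "0 < h"
  shows "integrable (gauss h) (\<lambda>x. val s (z + h + x))"
    and "(\<integral>x. val s (z + h + x) \<partial>gauss h) = val (s + h) z"
proof -
  have "integrable (gauss h) (\<lambda>x. val s (z + h + x)) \<and> (\<integral>x. val s (z + h + x) \<partial>gauss h) = val (s + h) z"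
  proof (cases "s = 0")
    case True
    then show ?thesis using assms integrable_payoff[of h "z + h"] by (simp add: val_def)
  next
    case False
    with assms have s: "0 < s" by simp
    show ?thesis
      using gauss_semigroup[OF s assms(2) integrable_payoff, of "z + h + s"] s assms(2)
      by (simp add: val_def algebra_simps)
  qed
  then show "integrable (gauss h) (\<lambda>x. val s (z + h + x))"
    and "(\<integral>x. val s (z + h + x) \<partial>gauss h) = val (s + h) z" by auto
qed

lemma val_closed_form:
  assumes d: "0 < d"
  shows "val d m = Phi ((m + d) / sqrt d) - exp (- 2 * m) * Phi ((d - m) / sqrt d)
          - exp (- (m + d / 2)) * (2 * Phi (m / sqrt d) - 1)"
proof -
  let ?c = "m + d"
  interpret prob_space "gauss d" by (rule prob_space_gauss) fact
  let ?e = "\<lambda>a x. indicator {-?c..} x * exp (- a * x) :: real"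
  have i: "integrable (gauss d) (?e a)" for a
    using d integrable_exp_gauss[OF d, of "-a"]
    by (intro Bochner_Integration.integrable_bound[OF integrable_exp_gauss[OF d, of "-a"]])
       (auto simp: indicator_def)
  have j: "integrable (gauss d) (\<lambda>x. exp (- a * x))" for a
    using integrable_exp_gauss[OF d, of "-a"] by simp
  \<comment> \<open>\<open>?e a\<close> is \<open>exp (- a * x)\<close> cut off to the half-line
    where the argument of \<open>payoff\<close> is nonnegative. The other branch is a full
    exponential minus its cut-off, so all integrals are those of
    \<open>integral_exp_gauss_tail\<close> and \<open>integral_exp_gauss\<close>.\<close>
  have p: "payoff (m + d + x) = ?e 0 x - exp (- ?c) * ?e 1 x
     + exp (- ?c) * (exp (- 1 * x) - ?e 1 x) - exp (- 2 * ?c) * (exp (- 2 * x) - ?e 2 x)" for x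
    by (auto simp: payoff_def indicator_def mult_exp_exp algebra_simps)
  have "has_bochner_integral (gauss d) (\<lambda>x. payoff (m + d + x))
    ((\<integral>x. ?e 0 x \<partial>gauss d) - exp (- ?c) * (\<integral>x. ?e 1 x \<partial>gauss d)
     + exp (- ?c) * ((\<integral>x. exp (- 1 * x) \<partial>gauss d) - (\<integral>x. ?e 1 x \<partial>gauss d))
     - exp (- 2 * ?c) * ((\<integral>x. exp (- 2 * x) \<partial>gauss d) - (\<integral>x. ?e 2 x \<partial>gauss d)))"
    unfolding p
    by (intro has_bochner_integral_diff has_bochner_integral_add has_bochner_integral_mult_right
        has_bochner_integral_integrable i j)
  then have "val d m = (\<integral>x. ?e 0 x \<partial>gauss d) - exp (- ?c) * (\<integral>x. ?e 1 x \<partial>gauss d)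
     + exp (- ?c) * ((\<integral>x. exp (- 1 * x) \<partial>gauss d) - (\<integral>x. ?e 1 x \<partial>gauss d))
     - exp (- 2 * ?c) * ((\<integral>x. exp (- 2 * x) \<partial>gauss d) - (\<integral>x. ?e 2 x \<partial>gauss d))"
    using d unfolding val_def by (subst if_not_P) (auto dest!: has_bochner_integral_integral_eq)
  also have "\<dots> = Phi (?c / sqrt d) - exp (- ?c) * (exp (d / 2) * Phi (m / sqrt d))
     + exp (- ?c) * (exp (d / 2) - exp (d / 2) * Phi (m / sqrt d))
     - exp (- 2 * ?c) * (exp (2 * d) - exp (2 * d) * Phi ((m - d) / sqrt d))"
    unfolding integral_exp_gauss_tail[OF d] integral_exp_gauss[OF d]
    by simp
  also have "exp (2 * d) - exp (2 * d) * Phi ((m - d) / sqrt d) = exp (2 * d) * Phi ((d - m) / sqrt d)"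
    using Phi_uminus[of "(m - d) / sqrt d"] by (simp add: right_diff_distrib minus_divide_left)
  also have "exp (- 2 * ?c) * (exp (2 * d) * Phi ((d - m) / sqrt d)) = exp (- 2 * m) * Phi ((d - m) / sqrt d)"
    by (simp add: mult_exp_exp mult.assoc[symmetric])
  also have "exp (- ?c) * (exp (d / 2) * Phi (m / sqrt d)) = exp (- ?c) * exp (d / 2) * Phi (m / sqrt d)"
    by (simp only: mult.assoc)
  also have "exp (- ?c) * (exp (d / 2) - exp (d / 2) * Phi (m / sqrt d))
      = exp (- ?c) * exp (d / 2) * (1 - Phi (m / sqrt d))"
    by (simp only: right_diff_distrib mult_1_right mult.assoc)
  also have "exp (- ?c) * exp (d / 2) = exp (- (m + d / 2))"
    by (simp add: mult_exp_exp)
  finally show ?thesis by (simp add: algebra_simps)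
qed

text \<open>This lets the shift in the grid comparison tend to 0. For \<open>d = 0\<close> only the
  branch \<open>1 - exp (- z)\<close> matters near \<open>m\<close>; otherwise the closed form is
  continuous.\<close>

lemma isCont_val:
  assumes "0 \<le> d" "0 < m" shows "isCont (val d) m"
proof (cases "d = 0")
  case True
  have "isCont (\<lambda>z. 1 - exp (- z)) m" by simp
  moreover have "eventually (\<lambda>z. 1 - exp (- z) = val d z) (nhds m)"
    using eventually_nhds_in_open[of "{0<..}" m] assms
    by (auto elim!: eventually_mono simp: val_def payoff_def True)
  ultimately show ?thesis using isCont_cong[of "\<lambda>z. 1 - exp (- z)" "val d" m] by simp
next
  case False
  with assms have d: "0 < d" by simp
  have "continuous_on UNIV (val d)"
    unfolding val_closed_form[OF d, abs_def]
    using d by (intro continuous_intros continuous_on_compose2[OF continuous_Phi]) auto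
  then show ?thesis by (simp add: continuous_on_eq_continuous_at)
qed

section \<open>Brownian motion along a time grid\<close>

text \<open>Fubini for the product of the two laws: \<open>X\<close> is frozen while
  \<open>Y\<close> is integrated out.\<close>

lemma (in prob_space) nn_integral_indep_pair:
  assumes ind: "indep_var S X T Y" and [measurable]: "F \<in> borel_measurable (S \<Otimes>\<^sub>M T)"
  shows "(\<integral>\<^sup>+\<omega>. F (X \<omega>, Y \<omega>) \<partial>M) = (\<integral>\<^sup>+\<omega>. (\<integral>\<^sup>+y. F (X \<omega>, y) \<partial>distr M T Y) \<partial>M)"
proof -
  have [measurable]: "random_variable S X" "random_variable T Y"
    and eq: "distr M S X \<Otimes>\<^sub>M distr M T Y = distr M (S \<Otimes>\<^sub>M T) (\<lambda>x. (X x, Y x))"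
    using ind by (auto simp: indep_var_distribution_eq)
  interpret Y: prob_space "distr M T Y" by (rule prob_space_distr) measurable
  have "(\<integral>\<^sup>+\<omega>. F (X \<omega>, Y \<omega>) \<partial>M) = (\<integral>\<^sup>+z. F z \<partial>(distr M S X \<Otimes>\<^sub>M distr M T Y))"
    unfolding eq by (subst nn_integral_distr) auto
  also have "\<dots> = (\<integral>\<^sup>+x. (\<integral>\<^sup>+y. F (x, y) \<partial>distr M T Y) \<partial>distr M S X)"
    by (subst Y.nn_integral_fst[symmetric]) auto
  also have "\<dots> = (\<integral>\<^sup>+\<omega>. (\<integral>\<^sup>+y. F (X \<omega>, y) \<partial>distr M T Y) \<partial>M)"
    by (subst nn_integral_distr) auto
  finally show ?thesis .
qed

locale brownian_motion = prob_space M for M :: "'a measure" +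
  fixes W :: "real \<Rightarrow> 'a \<Rightarrow> real"
  assumes std_bm: "std_brownian_motion M W"
begin

lemma W_measurable [measurable]: "W t \<in> borel_measurable M"
  using std_bm by (simp add: std_brownian_motion_def)

lemma W_0: "\<omega> \<in> space M \<Longrightarrow> W 0 \<omega> = 0"
  using std_bm by (simp add: std_brownian_motion_def)

lemma W_continuous: "\<omega> \<in> space M \<Longrightarrow> continuous_on {0..} (\<lambda>t. W t \<omega>)"
  using std_bm by (simp add: std_brownian_motion_def)

lemma distr_increment:
  assumes "0 \<le> s" "s < t"
  shows "distr M borel (\<lambda>\<omega>. W t \<omega> - W s \<omega>) = gauss (t - s)"
proof -
  have "distributed M lborel (\<lambda>\<omega>. W t \<omega> - W s \<omega>) (normal_density 0 (sqrt (t - s)))"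
    using std_bm assms by (simp add: std_brownian_motion_def)
  from distributed_distr_eq_density[OF this] show ?thesis
    by (simp add: gauss_def cong: distr_cong)
qed

definition grid_event :: "(nat \<Rightarrow> real) \<Rightarrow> real \<Rightarrow> nat \<Rightarrow> 'a set" where
  "grid_event c h n = {\<omega>\<in>space M. \<forall>k\<le>n. 0 < c k + W (real k * h) \<omega>}"

lemma sets_grid_event [measurable]: "grid_event c h n \<in> sets M"
  unfolding grid_event_def by measurable

lemma grid_event_Suc:
  "grid_event c h (Suc n) = grid_event c h n \<inter> {\<omega>\<in>space M. 0 < c (Suc n) + W (real (Suc n) * h) \<omega>}"
  by (auto simp: grid_event_def le_Suc_eq)

text \<open>Markov property at time \<open>n * h\<close>: since \<open>W 0 = 0\<close>, the path at
  the grid times up to then is a function of the first \<open>n\<close> increments. These are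
  independent of the next one, whose law is \<open>gauss h\<close>.\<close>

lemma grid_Markov_step:
  fixes F :: "real \<Rightarrow> real \<Rightarrow> ennreal"
  assumes h: "0 < h" and F [measurable]: "(\<lambda>(z, x). F z x) \<in> borel_measurable (borel \<Otimes>\<^sub>M borel)"
  shows "(\<integral>\<^sup>+\<omega>. indicator (grid_event c h n) \<omega> *
            F (W (real n * h) \<omega>) (W (real (Suc n) * h) \<omega> - W (real n * h) \<omega>) \<partial>M)
       = (\<integral>\<^sup>+\<omega>. indicator (grid_event c h n) \<omega> * (\<integral>\<^sup>+x. F (W (real n * h) \<omega>) x \<partial>gauss h) \<partial>M)"
proof -
  define D where "D i \<omega> = W (real (Suc i) * h) \<omega> - W (real i * h) \<omega>" for i \<omega>
  let ?P = "PiM {..<n} (\<lambda>_. borel :: real measure)"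
  let ?X = "\<lambda>\<omega>. restrict (\<lambda>i. D i \<omega>) {..<n}"
  have "indep_vars (\<lambda>_. borel) (\<lambda>i \<omega>. W (real (Suc i) * h) \<omega> - W (real i * h) \<omega>) {..<Suc n}"
    using std_bm h
    unfolding std_brownian_motion_def
    by (auto dest!: spec[where x="\<lambda>i. real i * h"] spec[where x="Suc n"])
  then have "indep_vars (\<lambda>_. borel) D {..<Suc n}"
    by (simp add: D_def[abs_def])
  \<comment> \<open>The increments split into the blocks \<open>{..<n}\<close> and
    \<open>{n}\<close>; the second is a family with a single member, read off below as
    \<open>q n\<close>.\<close>
  then have ind: "indep_var ?P ?X (PiM {n} (\<lambda>_. borel)) (\<lambda>\<omega>. restrict (\<lambda>i. D i \<omega>) {n})"
    by (rule indep_var_restrict) auto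
  have W_sum: "W (real k * h) \<omega> = (\<Sum>i<k. ?X \<omega> i)" if "\<omega> \<in> space M" "k \<le> n" for k \<omega>
  proof -
    have "(\<Sum>i<k. ?X \<omega> i) = (\<Sum>i<k. W (real (Suc i) * h) \<omega> - W (real i * h) \<omega>)"
      using that by (intro sum.cong) (auto simp: D_def)
    also have "\<dots> = W (real k * h) \<omega>"
      using sum_lessThan_telescope[of "\<lambda>i. W (real i * h) \<omega>" k] W_0[OF that(1)] by simp
    finally show ?thesis by simp
  qed
  define S where "S k p = (\<Sum>i<k. p i :: real)" for k :: nat and p
  have [measurable]: "S k \<in> borel_measurable ?P" if "k \<le> n" for k
    unfolding S_def[abs_def] using that by (intro borel_measurable_sum measurable_component_singleton) auto
  have W_S: "W (real k * h) \<omega> = S k (?X \<omega>)" if "\<omega> \<in> space M" "k \<le> n" for k \<omega>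
    using W_sum that by (simp add: S_def)
  have grid_S: "indicator (grid_event c h n) \<omega> = (indicator {p. \<forall>k\<in>{..n}. 0 < c k + S k p} (?X \<omega>) :: ennreal)"
    if "\<omega> \<in> space M" for \<omega>
    using W_S[OF that] that by (auto simp: grid_event_def indicator_def)
  let ?T = "distr M (PiM {n} (\<lambda>_. borel)) (\<lambda>\<omega>. restrict (\<lambda>i. D i \<omega>) {n})"
  let ?F = "\<lambda>(p, q). indicator {p. \<forall>k\<in>{..n}. 0 < c k + S k p} p * F (S n p) (q n)"
  have [measurable]: "Measurable.pred ?P (\<lambda>p. \<forall>k\<in>{..n}. 0 < c k + S k p)"
    by (intro pred_intros_finite) measurable
  have F_meas: "?F \<in> borel_measurable (?P \<Otimes>\<^sub>M PiM {n} (\<lambda>_. borel))"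
    by measurable
  have [measurable]: "D i \<in> borel_measurable M" for i
    unfolding D_def[abs_def] by measurable
  have distr: "distr M borel (D n) = gauss h"
    using distr_increment[of "real n * h" "real (Suc n) * h"] h
    by (simp add: D_def[abs_def] algebra_simps)
  have "(\<integral>\<^sup>+\<omega>. indicator (grid_event c h n) \<omega> * F (W (real n * h) \<omega>) (D n \<omega>) \<partial>M)
      = (\<integral>\<^sup>+\<omega>. ?F (?X \<omega>, restrict (\<lambda>i. D i \<omega>) {n}) \<partial>M)"
    by (intro nn_integral_cong) (simp add: grid_S W_S)
  also have "\<dots> = (\<integral>\<^sup>+\<omega>. (\<integral>\<^sup>+q. ?F (?X \<omega>, q) \<partial>?T) \<partial>M)"
    using nn_integral_indep_pair[OF ind F_meas] .
  also have "\<dots> = (\<integral>\<^sup>+\<omega>. indicator (grid_event c h n) \<omega> * (\<integral>\<^sup>+x. F (W (real n * h) \<omega>) x \<partial>gauss h) \<partial>M)"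
  proof (intro nn_integral_cong)
    fix \<omega> assume \<omega>: "\<omega> \<in> space M"
    have "(\<integral>\<^sup>+q. ?F (?X \<omega>, q) \<partial>?T)
      = (\<integral>\<^sup>+q. indicator (grid_event c h n) \<omega> * F (W (real n * h) \<omega>) (q n) \<partial>?T)"
      using \<omega> by (simp add: grid_S W_S)
    also have "\<dots> = (\<integral>\<^sup>+x. indicator (grid_event c h n) \<omega> * F (W (real n * h) \<omega>) x \<partial>distr M borel (D n))"
      by (simp add: nn_integral_distr)
    also have "\<dots> = indicator (grid_event c h n) \<omega> * (\<integral>\<^sup>+x. F (W (real n * h) \<omega>) x \<partial>gauss h)"
      unfolding distr by (intro nn_integral_cmult) measurable
    finally show "(\<integral>\<^sup>+q. ?F (?X \<omega>, q) \<partial>?T)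
      = indicator (grid_event c h n) \<omega> * (\<integral>\<^sup>+x. F (W (real n * h) \<omega>) x \<partial>gauss h)" .
  qed
  finally show ?thesis by (simp add: D_def)
qed

section \<open>Expected rewards of the killed walk\<close>

definition grid_expect :: "(nat \<Rightarrow> real) \<Rightarrow> real \<Rightarrow> (nat \<Rightarrow> real \<Rightarrow> ennreal) \<Rightarrow> nat \<Rightarrow> ennreal" where
  "grid_expect c h w n = (\<integral>\<^sup>+\<omega>. indicator (grid_event c h n) \<omega> * w n (c n + W (real n * h) \<omega>) \<partial>M)"

text \<open>One-step transition operator of the walk with drift \<open>c (Suc k) - c k\<close> that
  is killed outside \<open>{0<..}\<close>.\<close>

definition grid_step :: "(nat \<Rightarrow> real) \<Rightarrow> real \<Rightarrow> (nat \<Rightarrow> real \<Rightarrow> ennreal) \<Rightarrow> nat \<Rightarrow> real \<Rightarrow> ennreal" where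
  "grid_step c h w k z = (\<integral>\<^sup>+x. indicator {0<..} (z + (c (Suc k) - c k) + x)
       * w (Suc k) (z + (c (Suc k) - c k) + x) \<partial>gauss h)"

lemma grid_expect_0: "0 < c 0 \<Longrightarrow> grid_expect c h w 0 = w 0 (c 0)"
proof -
  assume "0 < c 0"
  then have "grid_expect c h w 0 = (\<integral>\<^sup>+\<omega>. w 0 (c 0) \<partial>M)"
    unfolding grid_expect_def
    by (intro nn_integral_cong) (simp add: grid_event_def W_0 indicator_def)
  then show ?thesis by (simp add: emeasure_space_1)
qed

lemma grid_expect_Suc:
  assumes h: "0 < h" and [measurable]: "w (Suc n) \<in> borel_measurable borel"
  shows "grid_expect c h w (Suc n)
       = (\<integral>\<^sup>+\<omega>. indicator (grid_event c h n) \<omega> * grid_step c h w n (c n + W (real n * h) \<omega>) \<partial>M)"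
proof -
  let ?G = "\<lambda>y :: real. indicator {0<..} y * w (Suc n) y"
  let ?F = "\<lambda>z x. ?G (c n + z + (c (Suc n) - c n) + x)"
  have "grid_expect c h w (Suc n) = (\<integral>\<^sup>+\<omega>. indicator (grid_event c h n) \<omega> *
            ?F (W (real n * h) \<omega>) (W (real (Suc n) * h) \<omega> - W (real n * h) \<omega>) \<partial>M)"
    unfolding grid_expect_def
    by (intro nn_integral_cong) (auto simp: grid_event_Suc indicator_def)
  also have "\<dots> = (\<integral>\<^sup>+\<omega>. indicator (grid_event c h n) \<omega> * (\<integral>\<^sup>+x. ?F (W (real n * h) \<omega>) x \<partial>gauss h) \<partial>M)"
    by (rule grid_Markov_step[OF h]) measurable
  finally show ?thesis by (simp add: grid_step_def)
qed

text \<open>Discrete supermartingale argument: on \<open>grid_event\<close> the walk is positive, so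
  the one-step inequality applies under the integral and the expected reward cannot increase with
  \<open>n\<close>.\<close>

lemma grid_expect_supersolution:
  assumes "0 < h" "0 < c 0" "\<And>k. w k \<in> borel_measurable borel"
    and step: "\<And>k z. k < N \<Longrightarrow> 0 < z \<Longrightarrow> grid_step c h w k z \<le> w k z"
  shows "n \<le> N \<Longrightarrow> grid_expect c h w n \<le> w 0 (c 0)"
proof (induction n)
  case (Suc n)
  have "grid_expect c h w (Suc n) \<le> grid_expect c h w n"
    unfolding grid_expect_Suc[OF assms(1,3)]
    unfolding grid_expect_def using Suc.prems
    by (intro nn_integral_mono) (auto simp: indicator_def grid_event_def intro!: step)
  with Suc show ?case by simp
qed (simp add: grid_expect_0 assms)

lemma grid_expect_subsolution:
  assumes "0 < h" "0 < c 0" "\<And>k. w k \<in> borel_measurable borel"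
    and step: "\<And>k z. k < N \<Longrightarrow> 0 < z \<Longrightarrow> w k z \<le> grid_step c h w k z"
  shows "n \<le> N \<Longrightarrow> w 0 (c 0) \<le> grid_expect c h w n"
proof (induction n)
  case (Suc n)
  have "grid_expect c h w n \<le> grid_expect c h w (Suc n)"
    unfolding grid_expect_Suc[OF assms(1,3)]
    unfolding grid_expect_def using Suc.prems
    by (intro nn_integral_mono) (auto simp: indicator_def grid_event_def intro!: step)
  with Suc show ?case by (meson Suc_leD order_trans)
qed (simp add: grid_expect_0 assms)

end

text \<open>The most drift that the smaller reserve can have gained by time \<open>t\<close> from an
  initial gap \<open>d\<close>: at most the whole drift \<open>t\<close>, and at most half of it
  plus half of the gap.\<close>

definition drift :: "real \<Rightarrow> real \<Rightarrow> real" where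
  "drift d t = min t ((t + d) / 2)"

lemma drift_before: "t \<le> d \<Longrightarrow> drift d t = t"
  by (simp add: drift_def)

lemma drift_after: "d \<le> t \<Longrightarrow> drift d t = (t + d) / 2"
  by (simp add: drift_def)

text \<open>While the drift is 1, with \<open>n0 - k\<close> steps left before the switch, the
  reflected function is used. From step \<open>n0\<close> on the drift is 1/2, and
  \<open>1 - exp (- z)\<close> is itself invariant on the whole line.\<close>

definition grid_val :: "real \<Rightarrow> nat \<Rightarrow> nat \<Rightarrow> real \<Rightarrow> real" where
  "grid_val h n0 k z = (if k < n0 then val (real (n0 - k) * h) z else 1 - exp (- z))"

lemma grid_val_measurable [measurable]: "0 < h \<Longrightarrow> grid_val h n0 k \<in> borel_measurable borel"
  unfolding grid_val_def[abs_def] by (cases "k < n0") (auto intro!: borel_measurable_val)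

lemma grid_val_0: "0 \<le> z \<Longrightarrow> grid_val h n0 0 z = val (real n0 * h) z"
  by (simp add: grid_val_def val_def payoff_def)

lemma grid_val_le_1: "0 < h \<Longrightarrow> grid_val h n0 k z \<le> 1"
  by (simp add: grid_val_def val_le_1)

text \<open>
  The \<open>grid_val\<close> are pre-images of each other under one Gaussian step. At \<open>Suc k = n0\<close> the
  function that is integrated, \<^term>\<open>payoff\<close>, differs from \<^term>\<open>grid_val h n0 (Suc k)\<close> on the
  negative axis, so it is hidden behind \<open>u\<close>.
\<close>
lemma grid_val_step:
  assumes h: "0 < h" and a: "a = drift (real n0 * h) (real (Suc k) * h) - drift (real n0 * h) (real k * h)"
  obtains u where "u \<in> borel_measurable borel" "h / 2 \<le> a"
    "\<And>z. integrable (gauss h) (\<lambda>x. u (z + a + x))"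
    "\<And>z. 0 \<le> z \<Longrightarrow> grid_val h n0 k z = (\<integral>x. u (z + a + x) \<partial>gauss h)"
    "\<And>z. 0 \<le> z \<Longrightarrow> grid_val h n0 (Suc k) z = u z"
    "\<And>z. 0 \<le> z \<Longrightarrow> 0 \<le> u z" "\<And>z. z \<le> 0 \<Longrightarrow> u z \<le> 0" "\<And>z. - exp (- 2 * z) \<le> u z"
proof (cases "k < n0")
  case True
  then have le: "real (Suc k) * h \<le> real n0 * h" "real k * h \<le> real n0 * h"
    using h by (auto intro!: mult_right_mono simp del: of_nat_Suc)
  have a: "a = h"
    unfolding a drift_before[OF le(1)] drift_before[OF le(2)] by (simp add: algebra_simps)
  let ?s = "real (n0 - Suc k) * h"
  have "n0 - k = Suc (n0 - Suc k)" using True by simp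
  then have "real (n0 - k) = real (n0 - Suc k) + 1" by simp
  then have s: "0 \<le> ?s" "?s + h = real (n0 - k) * h"
    using h by (auto simp only: distrib_right mult_1 intro!: mult_nonneg_nonneg)
  show thesis
  proof (rule that[of "val ?s"])
    show "val ?s \<in> borel_measurable borel" by (rule borel_measurable_val) (rule s)
    show "h / 2 \<le> a" using h a by simp
    show "integrable (gauss h) (\<lambda>x. val ?s (z + a + x))" for z
      unfolding a by (rule val_semigroup(1)[OF s(1) h])
    show "grid_val h n0 k z = (\<integral>x. val ?s (z + a + x) \<partial>gauss h)" for z
      unfolding a val_semigroup(2)[OF s(1) h] s using True by (simp add: grid_val_def)
    show "grid_val h n0 (Suc k) z = val ?s z" if "0 \<le> z" for z
      using that True by (auto simp: grid_val_def val_def payoff_def)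
    show "0 \<le> val ?s z" if "0 \<le> z" for z using s(1) that by (rule val_nonneg)
    show "val ?s z \<le> 0" if "z \<le> 0" for z using s(1) that by (rule val_nonpos)
    show "- exp (- 2 * z) \<le> val ?s z" for z using s(1) by (rule val_ge)
  qed
next
  case False
  then have le: "real n0 * h \<le> real k * h" "real n0 * h \<le> real (Suc k) * h"
    using h by (auto intro!: mult_right_mono)
  have a: "a = h / 2"
    unfolding a drift_after[OF le(1)] drift_after[OF le(2)] by (simp add: field_simps)
  interpret prob_space "gauss h" by (rule prob_space_gauss) (rule h)
  show thesis
  proof (rule that[of "\<lambda>z. 1 - exp (- z)"])
    have eq: "exp (- (z + a + x)) = exp (- (z + a)) * exp (- 1 * x)" for z x
      by (simp add: mult_exp_exp)
    show "integrable (gauss h) (\<lambda>x. 1 - exp (- (z + a + x)))" for z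
      unfolding eq using h
      by (intro Bochner_Integration.integrable_diff integrable_mult_right integrable_exp_gauss) auto
    \<comment> \<open>Invariance: the Gaussian mean contributes \<open>exp (h / 2)\<close>, which
      cancels the drift factor \<open>exp (- a)\<close> for \<open>a = h / 2\<close>.\<close>
    have "(\<integral>x. 1 - exp (- (z + a + x)) \<partial>gauss h) = 1 - exp (- (z + a)) * exp ((-1)\<^sup>2 * h / 2)" for z
      unfolding eq using prob_space integrable_exp_gauss[OF h, of "-1"] integral_exp_gauss[OF h, of "-1"]
      by (subst Bochner_Integration.integral_diff) auto
    then show "grid_val h n0 k z = (\<integral>x. 1 - exp (- (z + a + x)) \<partial>gauss h)" for z
      using False by (simp add: a grid_val_def mult_exp_exp)
    show "- exp (- 2 * z) \<le> 1 - exp (- z)" for z :: real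
    proof -
      have "exp (- 2 * z) = (exp (- z))\<^sup>2"
        by (simp add: power2_eq_square mult_exp_exp)
      \<comment> \<open>With \<open>q = exp (- z)\<close> the claim is
        \<open>0 \<le> q^2 - q + 1\<close>, and the right side is
        \<open>(q - 1 / 2)^2 + 3 / 4\<close>.\<close>
      moreover have "0 \<le> (exp (- z) - 1 / 2)\<^sup>2" by simp
      ultimately show ?thesis by (simp add: power2_eq_square algebra_simps)
    qed
  qed (use False a h in \<open>auto simp: grid_val_def\<close>)
qed

text \<open>Jumping over \<open>[-\<epsilon>, 0]\<close> in one step has probability of smaller order than \<open>h\<close>;
  \<open>l\<close> is the free parameter of a Chernoff bound for the loss caused by such a jump.\<close>
lemma upper_step:
  fixes u :: "real \<Rightarrow> real"
  assumes h: "0 < h" and a: "h / 2 \<le> a" and [measurable]: "u \<in> borel_measurable borel"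
    and int: "integrable (gauss h) (\<lambda>x. u (z + e + a + x))"
    and u_nonneg: "\<And>z. 0 \<le> z \<Longrightarrow> 0 \<le> u z" and u_ge: "\<And>z. - exp (- 2 * z) \<le> u z"
    and z: "0 < z" and A: "0 \<le> A" and B: "0 \<le> B" and l: "0 < l" and e: "0 \<le> e"
  shows "(\<integral>\<^sup>+x. indicator {0<..} (z + a + x)
            * ennreal (u (z + a + x + e) + A + exp (- (z + a + x) / 2) * B) \<partial>gauss h)
     \<le> ennreal ((\<integral>x. u (z + e + a + x) \<partial>gauss h) + exp (- l * e + (2 + l)\<^sup>2 * h / 2)
          + A + exp (- z / 2) * (exp (- h / 8) * B))"
proof -
  interpret prob_space "gauss h" by (rule prob_space_gauss) (rule h)
  let ?R = "\<lambda>x. exp (- l * e) * exp (- (2 + l) * x)"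
  let ?E = "\<lambda>x. exp (- (z + a) / 2) * B * exp (- (1 / 2) * x)"
  let ?f = "\<lambda>x. u (z + e + a + x) + ?R x + A + ?E x"
  \<comment> \<open>A negative value of \<open>u\<close> forces \<open>x + e < 0\<close>. The loss
    is then at most \<open>exp (- 2 * (x + e))\<close> and may be multiplied by
    \<open>exp (- l * (x + e)) \<ge> 1\<close>; the product is dominated by \<open>?R x\<close>,
    whose Gaussian mean is the error term of the statement.\<close>
  have pos: "0 \<le> u (z + e + a + x) + ?R x" for x
  proof (cases "0 \<le> z + e + a + x")
    case True
    then have "0 \<le> u (z + e + a + x)" by (rule u_nonneg)
    then show ?thesis by simp
  next
    case False
    with z a h have "x + e \<le> z + e + a + x" "x + e < 0" by auto
    then have "- 2 * (z + e + a + x) \<le> - 2 * (x + e) + - l * (x + e)"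
      using l mult_pos_neg[of l "x + e"] by simp
    also have "\<dots> \<le> - l * e + - (2 + l) * x"
      using e by (simp add: algebra_simps)
    finally have "exp (- 2 * (z + e + a + x)) \<le> ?R x"
      by (simp only: mult_exp_exp exp_le_cancel_iff)
    then show ?thesis using u_ge[of "z + e + a + x"] by linarith
  qed
  have E_eq: "exp (- (z + a + x) / 2) * B = ?E x" for x
  proof -
    have "- (z + a + x) / 2 = - (z + a) / 2 + - (1 / 2) * x" by (simp add: field_simps)
    then have "exp (- (z + a + x) / 2) = exp (- (z + a) / 2) * exp (- (1 / 2) * x)"
      by (simp only: exp_add)
    then show ?thesis by (simp only: mult_ac)
  qed
  have const: "has_bochner_integral (gauss h) (\<lambda>x. A) A"
    using prob_space by (simp add: has_bochner_integral_iff)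
  have I: "has_bochner_integral (gauss h) ?f
    ((\<integral>x. u (z + e + a + x) \<partial>gauss h) + exp (- l * e) * exp ((- (2 + l))\<^sup>2 * h / 2)
     + A + exp (- (z + a) / 2) * B * exp ((- (1 / 2))\<^sup>2 * h / 2))"
    by (intro has_bochner_integral_add has_bochner_integral_integrable[OF int] const
        has_bochner_integral_mult_right[OF has_bochner_integral_exp_gauss[OF h]])
  have f_nonneg: "0 \<le> ?f x" for x
    by (rule add_nonneg_nonneg[OF add_nonneg_nonneg[OF pos A]]) (simp add: B)
  have "(\<integral>\<^sup>+x. indicator {0<..} (z + a + x)
            * ennreal (u (z + a + x + e) + A + exp (- (z + a + x) / 2) * B) \<partial>gauss h)
      \<le> (\<integral>\<^sup>+x. ennreal (?f x) \<partial>gauss h)"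
    unfolding E_eq
    by (intro nn_integral_mono)
       (auto simp: indicator_def algebra_simps intro!: ennreal_leI)
  also have "\<dots> = ennreal (\<integral>x. ?f x \<partial>gauss h)"
    using I f_nonneg by (intro nn_integral_eq_integral) (auto simp: has_bochner_integral_iff)
  also have "\<dots> \<le> ennreal ((\<integral>x. u (z + e + a + x) \<partial>gauss h) + exp (- l * e + (2 + l)\<^sup>2 * h / 2)
          + A + exp (- z / 2) * (exp (- h / 8) * B))"
  proof (rule ennreal_leI)
    \<comment> \<open>Since \<open>h / 2 \<le> a\<close>, the drift contributes at most
      \<open>- h / 4\<close> to the exponent and the Gaussian mean adds \<open>h / 8\<close>, so
      each step damps this term by \<open>exp (- h / 8)\<close>.\<close>
    have "exp (- (z + a) / 2) * exp ((- (1 / 2))\<^sup>2 * h / 2) \<le> exp (- z / 2) * exp (- h / 8)"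
      using a by (simp add: mult_exp_exp power2_eq_square field_simps)
    from mult_right_mono[OF this B]
    show "(\<integral>x. ?f x \<partial>gauss h) \<le> (\<integral>x. u (z + e + a + x) \<partial>gauss h) + exp (- l * e + (2 + l)\<^sup>2 * h / 2)
          + A + exp (- z / 2) * (exp (- h / 8) * B)"
      unfolding has_bochner_integral_integral_eq[OF I]
      by (simp add: mult_exp_exp power2_commute mult_ac) (simp add: power2_eq_square algebra_simps)
  qed
  finally show ?thesis .
qed

text \<open>\<open>ennreal\<close> cuts negative values to 0, so the right-hand side integrates the
  positive part of \<open>f\<close>.\<close>

lemma ennreal_integral_le_nn_integral:
  fixes f :: "'a \<Rightarrow> real"
  assumes "integrable M f"
  shows "ennreal (\<integral>x. f x \<partial>M) \<le> (\<integral>\<^sup>+x. ennreal (f x) \<partial>M)"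
proof -
  have "(\<integral>x. f x \<partial>M) \<le> (\<integral>x. max 0 (f x) \<partial>M)"
    using assms by (intro integral_mono) auto
  then have "ennreal (\<integral>x. f x \<partial>M) \<le> ennreal (\<integral>x. max 0 (f x) \<partial>M)"
    by (rule ennreal_leI)
  also have "\<dots> = (\<integral>\<^sup>+x. ennreal (max 0 (f x)) \<partial>M)"
    using assms by (intro nn_integral_eq_integral[symmetric]) auto
  also have "\<dots> = (\<integral>\<^sup>+x. ennreal (f x) \<partial>M)"
    by (simp add: max_def ennreal_neg cong: if_cong) (auto intro!: nn_integral_cong simp: ennreal_neg)
  finally show ?thesis .
qed

lemma drift_altdef: "drift d t = min t d + (t - min t d) / 2"
proof (cases "t \<le> d")
  case True
  then show ?thesis by (simp add: drift_before)
next
  case False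
  then have "drift d t = (t + d) / 2" "min t d = d" by (simp_all add: drift_after)
  then show ?thesis by (simp add: field_simps)
qed

lemma drift_0: "0 \<le> d \<Longrightarrow> drift d 0 = 0"
  by (simp add: drift_before)

context brownian_motion
begin

text \<open>\<open>grid_val\<close> is a subsolution for the killed walk and never exceeds 1, so its
  expected terminal value is at most the survival probability.\<close>

lemma prob_grid_event_ge:
  assumes h: "0 < h" and m: "0 < m" and n: "n0 \<le> N"
  shows "val (real n0 * h) m \<le> prob (grid_event (\<lambda>k. m + drift (real n0 * h) (real k * h)) h N)"
proof -
  let ?c = "\<lambda>k. m + drift (real n0 * h) (real k * h)"
  let ?w = "\<lambda>k z. ennreal (grid_val h n0 k z)"
  have c0: "?c 0 = m" using h by (simp add: drift_0)
  have "ennreal (val (real n0 * h) m) = ?w 0 (?c 0)"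
    unfolding c0 using m by (simp add: grid_val_0)
  also have "\<dots> \<le> grid_expect ?c h ?w N"
  proof (rule grid_expect_subsolution[where N=N])
    fix k and z :: real assume "0 < z"
    obtain u where u: "u \<in> borel_measurable borel"
      "\<And>z. integrable (gauss h) (\<lambda>x. u (z + (?c (Suc k) - ?c k) + x))"
      "\<And>z. 0 \<le> z \<Longrightarrow> grid_val h n0 k z = (\<integral>x. u (z + (?c (Suc k) - ?c k) + x) \<partial>gauss h)"
      "\<And>z. 0 \<le> z \<Longrightarrow> grid_val h n0 (Suc k) z = u z" "\<And>z. z \<le> 0 \<Longrightarrow> u z \<le> 0"
      by (rule grid_val_step[OF h, of "?c (Suc k) - ?c k" n0 k]) auto
    have "?w k z \<le> (\<integral>\<^sup>+x. ennreal (u (z + (?c (Suc k) - ?c k) + x)) \<partial>gauss h)"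
      using \<open>0 < z\<close> u(2,3) by (simp add: ennreal_integral_le_nn_integral)
    \<comment> \<open>Outside \<open>{0<..}\<close> the integrand is nonpositive and becomes 0 in
      \<open>ennreal\<close>, so inserting the killing indicator loses nothing.\<close>
    also have "\<dots> \<le> grid_step ?c h ?w k z"
      unfolding grid_step_def
      by (intro nn_integral_mono) (auto simp: indicator_def not_less ennreal_neg u(4,5))
    finally show "?w k z \<le> grid_step ?c h ?w k z" .
  qed (use h m c0 in auto)
  also have "\<dots> \<le> (\<integral>\<^sup>+\<omega>. indicator (grid_event ?c h N) \<omega> \<partial>M)"
    unfolding grid_expect_def using grid_val_le_1[OF h]
    by (intro nn_integral_mono) (auto simp: indicator_def)
  also have "\<dots> = ennreal (prob (grid_event ?c h N))"
    by (simp add: emeasure_eq_measure)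
  finally show ?thesis by simp
qed

lemma prob_grid_event_le:
  assumes h: "0 < h" and m: "0 < m" and n: "n0 \<le> N" and l: "0 < l" and e: "0 \<le> e"
  shows "prob (grid_event (\<lambda>k. m + drift (real n0 * h) (real k * h)) h N)
     \<le> val (real n0 * h) (m + e) + real N * exp (- l * e + (2 + l)\<^sup>2 * h / 2) + exp (- m / 2) * exp (- real N * h / 8)"
proof -
  let ?c = "\<lambda>k. m + drift (real n0 * h) (real k * h)"
  let ?K = "exp (- l * e + (2 + l)\<^sup>2 * h / 2)"
  let ?B = "\<lambda>k. exp (- real (N - k) * h / 8)"
  \<comment> \<open>The supersolution: \<open>grid_val\<close> shifted by \<open>e\<close>, one jump
    error \<open>?K\<close> per remaining step, and a term that at the horizon covers the deficit
    \<open>exp (- (z + e))\<close> from 1 and is damped by \<open>exp (- h / 8)\<close> per step on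
    the way back to time 0.\<close>
  let ?w = "\<lambda>k z. ennreal (grid_val h n0 k (z + e) + real (N - k) * ?K + exp (- z / 2) * ?B k)"
  have c0: "?c 0 = m" using h by (simp add: drift_0)
  have "ennreal (prob (grid_event ?c h N)) = (\<integral>\<^sup>+\<omega>. indicator (grid_event ?c h N) \<omega> \<partial>M)"
    by (simp add: emeasure_eq_measure)
  also have "\<dots> \<le> grid_expect ?c h ?w N"
    unfolding grid_expect_def
  proof (intro nn_integral_mono)
    fix \<omega>
    have "1 \<le> ?w N z" if "0 < z" for z
    proof -
      have "exp (- (z + e)) \<le> exp (- z / 2)" using that e by simp
      then show ?thesis using n by (simp add: grid_val_def)
    qed
    then have "1 \<le> ?w N (?c N + W (real N * h) \<omega>)" if "\<omega> \<in> grid_event ?c h N"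
      using that unfolding grid_event_def by blast
    then show "indicator (grid_event ?c h N) \<omega> \<le> indicator (grid_event ?c h N) \<omega> * ?w N (?c N + W (real N * h) \<omega>)"
      by (cases "\<omega> \<in> grid_event ?c h N") (simp_all only: indicator_simps mult_1 mult_zero_left order_refl not_False_eq_True)
  qed
  also have "\<dots> \<le> ?w 0 (?c 0)"
  proof (rule grid_expect_supersolution[where N=N])
    fix k and z :: real assume k: "k < N" and z: "0 < z"
    let ?a = "?c (Suc k) - ?c k"
    obtain u where u: "u \<in> borel_measurable borel" "h / 2 \<le> ?a"
      "\<And>z. integrable (gauss h) (\<lambda>x. u (z + ?a + x))"
      "\<And>z. 0 \<le> z \<Longrightarrow> grid_val h n0 k z = (\<integral>x. u (z + ?a + x) \<partial>gauss h)"
      "\<And>z. 0 \<le> z \<Longrightarrow> grid_val h n0 (Suc k) z = u z" "\<And>z. 0 \<le> z \<Longrightarrow> 0 \<le> u z"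
      "\<And>z. - exp (- 2 * z) \<le> u z"
      by (rule grid_val_step[OF h, of ?a n0 k]) auto
    have Nk: "N - k = Suc (N - Suc k)" using k by simp
    have B: "exp (- h / 8) * ?B (Suc k) = ?B k"
      unfolding Nk by (simp add: mult_exp_exp field_simps)
    have "grid_step ?c h ?w k z = (\<integral>\<^sup>+x. indicator {0<..} (z + ?a + x)
            * ennreal (u (z + ?a + x + e) + real (N - Suc k) * ?K + exp (- (z + ?a + x) / 2) * ?B (Suc k)) \<partial>gauss h)"
      unfolding grid_step_def using e by (intro nn_integral_cong) (auto simp: indicator_def u(5))
    also have "\<dots> \<le> ennreal ((\<integral>x. u (z + e + ?a + x) \<partial>gauss h) + ?K
          + real (N - Suc k) * ?K + exp (- z / 2) * (exp (- h / 8) * ?B (Suc k)))"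
      by (rule upper_step) (use h u z l e in auto)
    also have "(\<integral>x. u (z + e + ?a + x) \<partial>gauss h) = grid_val h n0 k (z + e)"
      using u(4)[of "z + e"] z e by simp
    also have "grid_val h n0 k (z + e) + ?K + real (N - Suc k) * ?K = grid_val h n0 k (z + e) + real (N - k) * ?K"
      unfolding Nk by (simp add: algebra_simps)
    finally show "grid_step ?c h ?w k z \<le> ?w k z"
      unfolding B .
  next
    show "?w k \<in> borel_measurable borel" for k
      using h by measurable
  qed (use h m c0 in auto)
  also have "?w 0 (?c 0) = ennreal (val (real n0 * h) (m + e) + real N * ?K + exp (- m / 2) * exp (- real N * h / 8))"
    unfolding c0 using m e by (simp add: grid_val_0)
  finally show ?thesis
    using h m e val_nonneg[of "real n0 * h" "m + e"] by (subst (asm) ennreal_le_iff) auto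
qed

section \<open>Survival in continuous time\<close>

definition survival_set :: "real \<Rightarrow> real \<Rightarrow> 'a set" where
  "survival_set d m = {\<omega>\<in>space M. \<forall>t\<ge>0. 0 < m + drift d t + W t \<omega>}"

lemma continuous_path:
  "\<omega> \<in> space M \<Longrightarrow> continuous_on {0..} (\<lambda>t. m + drift d t + W t \<omega>)"
  unfolding drift_def by (intro continuous_intros W_continuous) auto

text \<open>Continuity makes the event countable: on each \<open>[0, K]\<close> a positive path
  attains a positive minimum, hence stays above some \<open>1 / (j + 1)\<close> at rational times;
  conversely such a bound passes to real times in the limit.\<close>

lemma sets_survival_set [measurable]: "survival_set d m \<in> sets M"
proof -
  let ?Z = "\<lambda>t \<omega>. m + drift d t + W t \<omega>"
  have "(\<forall>t\<ge>0. 0 < ?Z t \<omega>) \<longleftrightarrow>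
     (\<forall>K::nat. \<exists>j::nat. \<forall>q::rat. 0 \<le> real_of_rat q \<and> real_of_rat q \<le> real K \<longrightarrow> inverse (real (Suc j)) \<le> ?Z (real_of_rat q) \<omega>)"
    (is "?L \<longleftrightarrow> ?R") if \<omega>: "\<omega> \<in> space M" for \<omega>
  proof
    assume L: ?L
    show ?R
    proof
      fix K :: nat
      have "continuous_on {0..real K} (\<lambda>t. ?Z t \<omega>)"
        by (rule continuous_on_subset[OF continuous_path[OF \<omega>]]) auto
      then obtain t where t: "t \<in> {0..real K}" "\<And>s. s \<in> {0..real K} \<Longrightarrow> ?Z t \<omega> \<le> ?Z s \<omega>"
        using continuous_attains_inf[of "{0..real K}" "\<lambda>t. ?Z t \<omega>"] by auto
      then have "0 < ?Z t \<omega>" using L by simp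
      then obtain j where "inverse (real (Suc j)) < ?Z t \<omega>"
        using reals_Archimedean by blast
      then show "\<exists>j::nat. \<forall>q::rat. 0 \<le> real_of_rat q \<and> real_of_rat q \<le> real K \<longrightarrow> inverse (real (Suc j)) \<le> ?Z (real_of_rat q) \<omega>"
        using order_trans[OF less_imp_le t(2)] by (intro exI[of _ j]) auto
    qed
  next
    assume R: ?R
    show ?L
    proof (intro allI impI)
      fix t :: real assume t: "0 \<le> t"
      \<comment> \<open>The margin 1 keeps the rationals that approach \<open>t\<close> from above
        inside \<open>[0, K]\<close>.\<close>
      obtain K :: nat where K: "t + 1 \<le> real K" using real_arch_simple by blast
      obtain j where j: "\<And>q::rat. 0 \<le> real_of_rat q \<Longrightarrow> real_of_rat q \<le> real K \<Longrightarrow> inverse (real (Suc j)) \<le> ?Z (real_of_rat q) \<omega>"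
        using R by blast
      have "\<exists>q::rat. t < real_of_rat q \<and> real_of_rat q < t + inverse (real (Suc n))" for n
        by (rule of_rat_dense) simp
      then obtain q :: "nat \<Rightarrow> rat" where q: "\<And>n. t < real_of_rat (q n)" "\<And>n. real_of_rat (q n) < t + inverse (real (Suc n))"
        by metis
      have lim: "(\<lambda>n. real_of_rat (q n)) \<longlonglongrightarrow> t"
      proof (rule tendsto_sandwich[OF _ _ tendsto_const])
        show "(\<lambda>n. t + inverse (real (Suc n))) \<longlonglongrightarrow> t"
          using tendsto_add[OF tendsto_const LIMSEQ_inverse_real_of_nat, of t] by simp
      qed (use q in \<open>auto intro!: always_eventually less_imp_le simp del: of_nat_Suc\<close>)
      have le: "inverse (real (Suc j)) \<le> ?Z (real_of_rat (q n)) \<omega>" for n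
      proof (rule j)
        have "inverse (real (Suc n)) \<le> 1" by (simp add: field_simps)
        then show "real_of_rat (q n) \<le> real K" using q(2)[of n] K by linarith
      qed (use q(1)[of n] t in linarith)
      have "(\<lambda>n. ?Z (real_of_rat (q n)) \<omega>) \<longlonglongrightarrow> ?Z t \<omega>"
        using t less_imp_le[OF le_less_trans[OF t q(1)]]
        by (intro continuous_on_tendsto_compose[OF continuous_path[OF \<omega>] lim]) auto
      then have "inverse (real (Suc j)) \<le> ?Z t \<omega>"
        using le by (intro LIMSEQ_le_const) auto
      then show "0 < ?Z t \<omega>" by (rule less_le_trans[rotated]) simp
    qed
  qed
  then have "survival_set d m = {\<omega>\<in>space M. \<forall>K::nat. \<exists>j::nat. \<forall>q::rat. 0 \<le> real_of_rat q \<and> real_of_rat q \<le> real K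
       \<longrightarrow> inverse (real (Suc j)) \<le> ?Z (real_of_rat q) \<omega>}"
    unfolding survival_set_def by blast
  also have "\<dots> \<in> sets M" by measurable
  finally show ?thesis .
qed

text \<open>Writing \<open>d\<close> as 0 or 1 times a positive unit \<open>D\<close> makes the
  switching time a grid point of every mesh \<open>D / n\<close>, also for
  \<open>d = 0\<close>.\<close>

lemma prob_survival_le:
  assumes m: "0 < m" and e: "0 < e" and d: "d = real j * D" and j: "j \<le> 1" and D: "0 < D"
  shows "prob (survival_set d m) \<le> val d (m + e)"
proof -
  \<comment> \<open>The error for mesh \<open>h = D / n\<close>, \<open>n^2\<close> steps (horizon
    \<open>n * D\<close>) and \<open>l = 1 / sqrt h\<close>. Then \<open>l^2 * h = 1\<close> stays
    bounded, while \<open>exp (- l * e)\<close> beats the factor \<open>n^2\<close>.\<close>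
  define b where "b n = real n ^ 2 * exp (- sqrt (real n / D) * e + (2 + sqrt (real n / D))\<^sup>2 * (D / real n) / 2)
       + exp (- m / 2) * exp (- real n * D / 8)" for n :: nat
  have le: "prob (survival_set d m) \<le> val d (m + e) + b n" if n: "0 < n" for n
  proof -
    let ?h = "D / real n" and ?n0 = "j * n" and ?N = "n ^ 2"
    have h: "0 < ?h" using D n by simp
    have d': "d = real ?n0 * ?h" using n d by simp
    have "?n0 \<le> ?N" using j n by (auto simp: power2_eq_square)
    have "prob (survival_set d m) \<le> prob (grid_event (\<lambda>k. m + drift (real ?n0 * ?h) (real k * ?h)) ?h ?N)"
      using h unfolding d'[symmetric] survival_set_def grid_event_def
      by (intro finite_measure_mono sets_grid_event[unfolded grid_event_def])
         (auto simp del: times_divide_eq_right intro: mult_nonneg_nonneg)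
    also have "\<dots> \<le> val (real ?n0 * ?h) (m + e)
        + real ?N * exp (- sqrt (real n / D) * e + (2 + sqrt (real n / D))\<^sup>2 * ?h / 2) + exp (- m / 2) * exp (- real ?N * ?h / 8)"
      by (rule prob_grid_event_le) (use h m e n D \<open>?n0 \<le> ?N\<close> in auto)
    also have "\<dots> = val d (m + e) + b n"
      unfolding d'[symmetric] b_def using n by (simp add: power2_eq_square)
    finally show ?thesis .
  qed
  have "b \<longlonglongrightarrow> 0"
    unfolding b_def[abs_def] using D e by real_asymp
  then have "(\<lambda>n. val d (m + e) + b n) \<longlonglongrightarrow> val d (m + e) + 0"
    by (intro tendsto_intros)
  then show ?thesis
    using le by (intro LIMSEQ_le_const[where X="\<lambda>n. val d (m + e) + b n"]) (auto intro!: exI[of _ 1])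
qed

lemma prob_survival_ge:
  assumes m: "0 < m" and e: "0 < e" and d: "d = real j * D" and j: "j \<le> 1" and D: "0 < D"
  shows "val d m \<le> prob (survival_set d (m + e))"
proof -
  \<comment> \<open>Dyadic meshes make the grids nested, and \<open>4 ^ n\<close> steps push the
    horizon \<open>2 ^ n * D\<close> to infinity.\<close>
  define h where "h n = D / 2 ^ n" for n :: nat
  have h: "0 < h n" for n using D by (simp add: h_def)
  define A where "A n = grid_event (\<lambda>k. m + drift d (real k * h n)) (h n) (4 ^ n)" for n
  have A_ge: "val d m \<le> prob (A n)" for n
  proof -
    have d': "d = real (j * 2 ^ n) * h n" using d by (simp add: h_def)
    have "(2::nat) ^ n \<le> 4 ^ n" by (rule power_mono) auto
    then have "j * 2 ^ n \<le> 4 ^ n" using mult_le_mono[OF j] by (metis mult_1 order_trans order_refl)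
    then show ?thesis
      unfolding A_def using prob_grid_event_ge[OF h[of n] m, of "j * 2 ^ n" "4 ^ n"] d' by simp
  qed
  have "decseq A"
  proof (rule decseq_SucI, rule subsetI)
    fix n \<omega> assume \<omega>: "\<omega> \<in> A (Suc n)"
    have "0 < m + drift d (real k * h n) + W (real k * h n) \<omega>" if "k \<le> 4 ^ n" for k
    proof -
      have "2 * k \<le> 4 ^ Suc n" using that by simp
      moreover have "real (2 * k) * h (Suc n) = real k * h n" by (simp add: h_def)
      moreover from calculation(1)
      have "0 < m + drift d (real (2 * k) * h (Suc n)) + W (real (2 * k) * h (Suc n)) \<omega>"
        using \<omega> unfolding A_def grid_event_def by blast
      ultimately show ?thesis by (simp only:)
    qed
    with \<omega> show "\<omega> \<in> A n" by (auto simp: A_def grid_event_def)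
  qed
  then have "(\<lambda>n. prob (A n)) \<longlonglongrightarrow> prob (\<Inter>n. A n)"
    by (rule finite_Lim_measure_decseq[rotated]) (use A_def in auto)
  then have "val d m \<le> prob (\<Inter>n. A n)"
    using A_ge by (intro LIMSEQ_le_const) auto
  also have "\<dots> \<le> prob (survival_set d (m + e))"
  proof (rule finite_measure_mono)
    show "(\<Inter>n. A n) \<subseteq> survival_set d (m + e)"
    proof
      fix \<omega> assume "\<omega> \<in> (\<Inter>n. A n)"
      then have A: "\<omega> \<in> A n" for n by blast
      then have \<omega>: "\<omega> \<in> space M" by (auto simp: A_def grid_event_def)
      have "0 < m + e + drift d t + W t \<omega>" if t: "0 \<le> t" for t
      proof -
        define k where "k n = nat \<lfloor>t / h n\<rfloor>" for n
        have k_le: "real (k n) \<le> t / h n" "t / h n < real (k n) + 1" for n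
          using t h[of n] by (auto simp: k_def)
        have k: "real (k n) * h n \<le> t" "t < real (k n) * h n + h n" for n
          using k_le[of n] h[of n] by (auto simp: field_simps)
        have lim: "(\<lambda>n. real (k n) * h n) \<longlonglongrightarrow> t"
        proof (rule tendsto_sandwich[OF _ _ _ tendsto_const])
          show "(\<lambda>n. t - h n) \<longlonglongrightarrow> t"
            unfolding h_def by real_asymp
        qed (use k(1) less_imp_le[OF k(2)] in \<open>auto simp: diff_le_eq\<close>)
        have ev: "eventually (\<lambda>n. 0 \<le> m + drift d (real (k n) * h n) + W (real (k n) * h n) \<omega>) sequentially"
        proof -
          have "eventually (\<lambda>n. t / D \<le> 2 ^ n) sequentially"
            by real_asymp
          then show ?thesis
          proof eventually_elim
            case (elim n)
            have "real (k n) \<le> t / D * 2 ^ n" using k_le(1)[of n] by (simp add: h_def)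
            also have "\<dots> \<le> 2 ^ n * 2 ^ n" using elim by (intro mult_right_mono) auto
            also have "\<dots> = real (4 ^ n)" by (simp flip: power_mult_distrib)
            finally have "k n \<le> 4 ^ n" by (simp only: of_nat_le_iff)
            then show ?case using A[of n] by (auto simp: A_def grid_event_def intro!: less_imp_le)
          qed
        qed
        have "(\<lambda>n. m + drift d (real (k n) * h n) + W (real (k n) * h n) \<omega>) \<longlonglongrightarrow> m + drift d t + W t \<omega>"
          using t h by (intro continuous_on_tendsto_compose[OF continuous_path[OF \<omega>] lim])
            (auto intro!: always_eventually mult_nonneg_nonneg less_imp_le[OF h])
        \<comment> \<open>Positivity at dyadic times gives only \<open>\<ge> 0\<close> in the limit;
          the extra \<open>e\<close> restores strictness.\<close>
        then have "0 \<le> m + drift d t + W t \<omega>"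
          using ev by (rule tendsto_lowerbound) simp
        then show ?thesis using e by simp
      qed
      with \<omega> show "\<omega> \<in> survival_set d (m + e)" by (simp add: survival_set_def)
    qed
  qed simp
  finally show ?thesis .
qed

lemma prob_survival_set:
  assumes m: "0 < m" and d: "0 \<le> d"
  shows "prob (survival_set d m) = val d m"
proof (rule antisym)
  obtain j D where D: "0 < D" "d = real j * D" "j \<le> 1"
    using d that[of 1 0] that[of d 1] by (cases "d = 0") auto
  have cont: "isCont (val d) m" using d m by (rule isCont_val)
  have "(\<lambda>n. m + m / real (n + 2)) \<longlonglongrightarrow> m" by real_asymp
  then have "(\<lambda>n. val d (m + m / real (n + 2))) \<longlonglongrightarrow> val d m"
    by (rule isCont_tendsto_compose[OF cont])
  then show "prob (survival_set d m) \<le> val d m"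
    using m D by (intro LIMSEQ_le_const) (auto intro!: prob_survival_le)
  \<comment> \<open>The denominator \<open>n + 2\<close> keeps the lowered start at least
    \<open>m / 2\<close>, hence positive.\<close>
  have "(\<lambda>n. m - m / real (n + 2)) \<longlonglongrightarrow> m" by real_asymp
  then have "(\<lambda>n. val d (m - m / real (n + 2))) \<longlonglongrightarrow> val d m"
    by (rule isCont_tendsto_compose[OF cont])
  moreover have "val d (m - m / real (n + 2)) \<le> prob (survival_set d m)" for n
  proof -
    have "0 < m - m / real (n + 2)" using m by (simp add: field_simps add_pos_nonneg)
    from prob_survival_ge[OF this _ D(2,3,1), of "m / real (n + 2)"] show ?thesis
      using m by simp
  qed
  ultimately show "val d m \<le> prob (survival_set d m)"
    by (intro LIMSEQ_le_const2) auto
qed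

section \<open>The optimal control\<close>

lemma survival_event_subset:
  assumes u: "u \<in> admissible_controls M W"
  shows "survival_event M W x y u \<subseteq> survival_set \<bar>y - x\<bar> (min x y)"
proof
  fix \<omega> assume \<omega>: "\<omega> \<in> survival_event M W x y u"
  then have \<omega>M: "\<omega> \<in> space M" by (simp add: survival_event_def)
  have "0 < min x y + drift \<bar>y - x\<bar> t + W t \<omega>" if t: "0 \<le> t" for t
  proof -
    have bd: "0 \<le> u s \<omega>" "u s \<omega> \<le> 1" if "0 \<le> s" for s
      using u that \<omega>M by (auto simp: admissible_controls_def)
    \<comment> \<open>The integral of a non-integrable function is 0 by convention, so progressive
      measurability is needed to make the section at \<open>\<omega>\<close> integrable before its
      integral can be bounded.\<close>
    have "(\<lambda>(s, \<omega>). u s \<omega>) \<in> borel_measurable (restrict_space borel {0..t} \<Otimes>\<^sub>M nat_filtration M W t)"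
      using u t by (auto simp: admissible_controls_def)
    moreover have "\<omega> \<in> space (nat_filtration M W t)"
      using \<omega>M unfolding nat_filtration_def by (subst space_measure_of) auto
    ultimately have "(\<lambda>s. u s \<omega>) \<in> borel_measurable (restrict_space borel {0..t})"
      using measurable_Pair1[of "\<lambda>(s, \<omega>). u s \<omega>"] by fastforce
    then have meas: "(\<lambda>s. indicator {0..t} s *\<^sub>R u s \<omega>) \<in> borel_measurable lborel"
      by (simp add: borel_measurable_restrict_space_iff mult.commute)
    have int: "set_integrable lborel {0..t} (\<lambda>s. u s \<omega>)"
      unfolding set_integrable_def
      by (rule Bochner_Integration.integrable_bound[OF integrable_real_indicator[of "{0..t}"]])
         (use meas bd t in \<open>auto simp: indicator_def\<close>)
    have one: "set_integrable lborel {0..t} (\<lambda>s. 1 :: real)"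
      unfolding set_integrable_def using t by simp
    have int1: "(LINT s:{0..t}|lborel. (1::real)) = t"
      using t by (simp add: set_lebesgue_integral_def)
    define I where "I = (LINT s:{0..t}|lborel. u s \<omega>)"
    have "(LINT s:{0..t}|lborel. (0::real)) \<le> I"
      unfolding I_def using bd by (intro set_integral_mono int) (auto simp: set_integrable_def)
    then have I0: "0 \<le> I" by (simp add: set_lebesgue_integral_def)
    have "I \<le> (LINT s:{0..t}|lborel. (1::real))"
      unfolding I_def using bd by (intro set_integral_mono int one) auto
    then have I1: "I \<le> t" by (simp add: int1)
    have I2: "(LINT s:{0..t}|lborel. 1 - u s \<omega>) = t - I"
      using set_integral_diff(2)[OF one int] by (simp add: I_def int1)
    have "0 < x + W t \<omega> + I" "0 < y + W t \<omega> + (t - I)"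
      using \<omega> t I2 by (auto simp: survival_event_def X_proc_def Y_proc_def I_def)
    \<comment> \<open>The first bound gives the smaller reserve the whole drift; the second is the
      average of the two reserves, in which the control cancels. Together they form the minimum in
      \<open>drift\<close>.\<close>
    then have "0 < min x y + W t \<omega> + t" and "0 < (x + y) / 2 + W t \<omega> + t / 2"
      using I0 I1 by (linarith, argo)
    moreover have "(x + y) / 2 = min x y + \<bar>y - x\<bar> / 2" by (simp add: min_def field_simps)
    ultimately show ?thesis unfolding drift_def min_def[of t] by (auto simp: add_divide_distrib)
  qed
  with \<omega>M show "\<omega> \<in> survival_set \<bar>y - x\<bar> (min x y)" by (simp add: survival_set_def)
qed

text \<open>The gap closes at rate 1, so the reserves meet at time \<open>\<bar>y - x\<bar>\<close>
  and stay equal under the even split.\<close>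

definition catch_up :: "real \<Rightarrow> real \<Rightarrow> real \<Rightarrow> 'a \<Rightarrow> real" where
  "catch_up x y s \<omega> = (if s < \<bar>y - x\<bar> then of_bool (x \<le> y) else 1 / 2)"

text \<open>The control is deterministic, so measurability concerns the time coordinate alone and
  holds over every sigma-algebra \<open>N\<close>.\<close>

lemma catch_up_admissible: "catch_up x y \<in> admissible_controls M W"
proof -
  let ?f = "\<lambda>s :: real. if s < \<bar>y - x\<bar> then of_bool (x \<le> y) else 1 / 2 :: real"
  have "(\<lambda>(s, \<omega>). catch_up x y s \<omega>) \<in> borel_measurable (restrict_space borel {0..t} \<Otimes>\<^sub>M N)" for t and N :: "'a measure"
  proof -
    have "?f \<in> borel_measurable (restrict_space borel {0..t})"
      by (rule measurable_restrict_space1) measurable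
    then have "(\<lambda>p. ?f (fst p)) \<in> borel_measurable (restrict_space borel {0..t} \<Otimes>\<^sub>M N)"
      by (rule measurable_compose[OF measurable_fst])
    then show ?thesis unfolding catch_up_def case_prod_beta' .
  qed
  moreover have "0 \<le> catch_up x y s \<omega> \<and> catch_up x y s \<omega> \<le> 1" for s and \<omega> :: 'a
    by (simp add: catch_up_def)
  ultimately show ?thesis unfolding admissible_controls_def by blast
qed

lemma catch_up_integral:
  assumes t: "0 \<le> t"
  shows "(LINT s:{0..t}|lborel. catch_up x y s \<omega>)
       = of_bool (x \<le> y) * min t \<bar>y - x\<bar> + (t - min t \<bar>y - x\<bar>) / 2"
    and "(LINT s:{0..t}|lborel. 1 - catch_up x y s \<omega>)
       = (1 - of_bool (x \<le> y)) * min t \<bar>y - x\<bar> + (t - min t \<bar>y - x\<bar>) / 2"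
proof -
  let ?d = "min t \<bar>y - x\<bar>"
  have split: "(LINT s:{0..t}|lborel. if s < \<bar>y - x\<bar> then a else 1 / 2) = a * ?d + (t - ?d) / 2" for a :: real
  proof (cases "t < \<bar>y - x\<bar>")
    case True
    then have "(LINT s:{0..t}|lborel. if s < \<bar>y - x\<bar> then a else 1 / 2) = (\<integral>s. a * indicator {0..t} s \<partial>lborel)"
      unfolding set_lebesgue_integral_def
      by (intro Bochner_Integration.integral_cong) (auto simp: indicator_def)
    then show ?thesis using t True by simp
  next
    case False
    then have "(LINT s:{0..t}|lborel. if s < \<bar>y - x\<bar> then a else 1 / 2)
       = (\<integral>s. a * indicator {0..<\<bar>y - x\<bar>} s + 1 / 2 * indicator {\<bar>y - x\<bar>..t} s \<partial>lborel)"
      unfolding set_lebesgue_integral_def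
      by (intro Bochner_Integration.integral_cong) (auto simp: indicator_def)
    also have "\<dots> = a * \<bar>y - x\<bar> + (t - \<bar>y - x\<bar>) / 2"
      using False by (subst Bochner_Integration.integral_add) auto
    finally show ?thesis using False by simp
  qed
  show "(LINT s:{0..t}|lborel. catch_up x y s \<omega>) = of_bool (x \<le> y) * ?d + (t - ?d) / 2"
    unfolding catch_up_def by (rule split)
  have "1 - catch_up x y s \<omega> = (if s < \<bar>y - x\<bar> then 1 - of_bool (x \<le> y) else 1 / 2)" for s
    by (simp add: catch_up_def)
  then show "(LINT s:{0..t}|lborel. 1 - catch_up x y s \<omega>) = (1 - of_bool (x \<le> y)) * ?d + (t - ?d) / 2"
    by (simp only: split)
qed

lemma survival_event_catch_up: "survival_event M W x y (catch_up x y) = survival_set \<bar>y - x\<bar> (min x y)"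
proof
  show "survival_set \<bar>y - x\<bar> (min x y) \<subseteq> survival_event M W x y (catch_up x y)"
  proof
    fix \<omega> assume \<omega>: "\<omega> \<in> survival_set \<bar>y - x\<bar> (min x y)"
    have "0 < X_proc W x (catch_up x y) t \<omega> \<and> 0 < Y_proc W y (catch_up x y) t \<omega>" if t: "0 \<le> t" for t
    proof -
      have "0 < min x y + drift \<bar>y - x\<bar> t + W t \<omega>"
        using \<omega> t by (simp add: survival_set_def)
      moreover have "drift \<bar>y - x\<bar> t = min t \<bar>y - x\<bar> + (t - min t \<bar>y - x\<bar>) / 2"
        by (rule drift_altdef)
      \<comment> \<open>The richer company starts ahead by the gap, which is at least the drift it
        forgoes, so it stays at or above the poorer one.\<close>
      moreover have "min t \<bar>y - x\<bar> \<le> \<bar>y - x\<bar>" by simp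
      ultimately show ?thesis
        unfolding X_proc_def Y_proc_def catch_up_integral[OF t]
        by (cases "x \<le> y") simp_all
    qed
    with \<omega> show "\<omega> \<in> survival_event M W x y (catch_up x y)"
      by (simp add: survival_event_def survival_set_def)
  qed
qed (rule survival_event_subset[OF catch_up_admissible])

lemma value_fun_eq:
  assumes "0 < x" "0 < y"
  shows "value_fun M W x y = val \<bar>y - x\<bar> (min x y)"
proof -
  have "value_fun M W x y = prob (survival_set \<bar>y - x\<bar> (min x y))"
    unfolding value_fun_def
  proof (rule cSup_eq_maximum)
    show "prob (survival_set \<bar>y - x\<bar> (min x y)) \<in> (\<lambda>u. prob (survival_event M W x y u)) ` admissible_controls M W"
      using catch_up_admissible survival_event_catch_up by (metis image_eqI)
  qed (auto intro!: finite_measure_mono survival_event_subset)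
  also have "\<dots> = val \<bar>y - x\<bar> (min x y)"
    using assms by (intro prob_survival_set) auto
  finally show ?thesis .
qed

end

theorem theorem3p1:
  fixes M :: "'a measure" and W :: "real \<Rightarrow> 'a \<Rightarrow> real" and x y :: real
  assumes "std_brownian_motion M W" and "x > 0" and "y > 0"
  shows "value_fun M W x y =
    (if y = x then 1 - exp (- x)
     else Phi (max x y / sqrt \<bar>y - x\<bar>)
          - exp (- 2 * min x y) * Phi ((\<bar>y - x\<bar> - min x y) / sqrt \<bar>y - x\<bar>)
          - exp (- (x + y) / 2) * (2 * Phi (min x y / sqrt \<bar>y - x\<bar>) - 1))"
proof -
  interpret brownian_motion M W
    using assms(1) by (auto simp: brownian_motion_def brownian_motion_axioms_def std_brownian_motion_def)
  show ?thesis
  proof (cases "y = x")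
    case True
    then show ?thesis using assms by (simp add: value_fun_eq val_def payoff_def)
  next
    case False
    have "min x y + \<bar>y - x\<bar> = max x y" "- (min x y + \<bar>y - x\<bar> / 2) = - (x + y) / 2"
      by (auto simp: min_def max_def field_simps)
    then show ?thesis
      using False assms val_closed_form[of "\<bar>y - x\<bar>" "min x y"]
      by (simp only: value_fun_eq if_False zero_less_abs_iff right_minus_eq not_False_eq_True)
  qed
qed

end
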